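(* For every positive integer $\chi$ there are arbitrarily large positive integers $N$ for which there exist tournaments $T_1$ and $T_2$ on the same $N$-vertex set $V$ such that $\chi(T_1) = \chi$ and, for every set $U \subseteq V$ of at most $\frac{\log N}{8\chi^2}$ vertices, $\chi(T_1[N_{T_2}^+(U)]) \leq 2$.
   Context: A tournament is an orientation of a finite complete graph. The chromatic number $\chi(T)$ of a tournament $T$ is the least $k$ for which there is a partition of $V(T)$ into $k$ parts each of which induces a transitive (acyclic) subtournament of $T$. $T[S]$ denotes the subtournament induced on a vertex set $S$. For a tournament $T$, $N_T^+(v)$ is the set of vertices $w$ such that $T$ has an arc from $v$ to $w$, and for a vertex set $U$, $N_T^+(U) = \bigcup_{v \in U} N_T^+(v)$, which might contain vertices of $U$. $\log$ denotes the natural logarithm. *)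

theory Defs
  imports Complex_Main "HOL-Library.Disjoint_Sets" "Graph_Theory.Graph_Theory"
begin

locale tournament = digraph T for T :: "('a, 'b) pre_digraph" (structure) +
  assumes oriented_complete:
    "\<lbrakk>u \<in> verts T; v \<in> verts T; u \<noteq> v\<rbrakk> \<Longrightarrow> (u \<rightarrow>\<^bsub>T\<^esub> v) \<longleftrightarrow> \<not> (v \<rightarrow>\<^bsub>T\<^esub> u)"

definition transitive_digraph :: "('a, 'b) pre_digraph \<Rightarrow> bool" where
  "transitive_digraph G \<longleftrightarrow> trans (arcs_ends G)"

text \<open>
  The parts of a \<^const>\<open>partition_on\<close> are nonempty. Allowing empty parts would not change the
  least number of parts. The empty tournament has chromatic number 0.
\<close>

definition chromatic_number :: "('a, 'b) pre_digraph \<Rightarrow> nat" where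
  "chromatic_number T =
    (LEAST k. \<exists>P. partition_on (verts T) P \<and> card P = k \<and>
                  (\<forall>S\<in>P. transitive_digraph (T \<restriction> S)))"

definition out_neighbourhood :: "('a, 'b) pre_digraph \<Rightarrow> 'a set \<Rightarrow> 'a set" where
  "out_neighbourhood T U = (\<Union>v\<in>U. {w. v \<rightarrow>\<^bsub>T\<^esub> w})"

lemma (in tournament) tournament_induce_subgraph:
  assumes "S \<subseteq> verts T"
  shows "tournament (T \<restriction> S)"
proof -
  interpret I: digraph "T \<restriction> S"
    using assms by (intro digraphI_induced induced_induce)
  show ?thesis
  proof
    fix u v assume "u \<in> verts (T \<restriction> S)" "v \<in> verts (T \<restriction> S)" "u \<noteq> v"
    then show "(u \<rightarrow>\<^bsub>T \<restriction> S\<^esub> v) \<longleftrightarrow> \<not> (v \<rightarrow>\<^bsub>T \<restriction> S\<^esub> u)"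
      using oriented_complete[of u v] assms
      by (auto simp: arcs_ends_conv induce_subgraph_def)
  qed
qed

lemma (in tournament) transitive_iff_acyclic:
  "transitive_digraph T \<longleftrightarrow> acyclic (arcs_ends T)"
proof
  assume "transitive_digraph T"
  then show "acyclic (arcs_ends T)"
    using adj_not_same by (auto simp: transitive_digraph_def acyclic_def trancl_id)
next
  assume ac: "acyclic (arcs_ends T)"
  show "transitive_digraph T"
    unfolding transitive_digraph_def
  proof (rule transI)
    fix x y z assume xy: "(x, y) \<in> arcs_ends T" and yz: "(y, z) \<in> arcs_ends T"
    then have xz: "(x, z) \<in> (arcs_ends T)\<^sup>+" by auto
    then have "x \<noteq> z" using ac by (auto simp: acyclic_def)
    moreover have "x \<in> verts T" "z \<in> verts T"
      using xy yz adj_in_verts by auto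
    moreover have "(z, x) \<notin> arcs_ends T"
      using xz ac by (meson acyclic_def trancl.trancl_into_trancl)
    ultimately show "(x, z) \<in> arcs_ends T" using oriented_complete by blast
  qed
qed

end

theory Submission
  imports Defs "HOL-Library.Multiset" "HOL-Library.Nat_Bijection" "HOL-Library.Z2"
    "HOL-Real_Asymp.Real_Asymp"
begin

text \<open>
  For \<open>\<chi> \<le> 2\<close> the tournament \<open>T\<^sub>1\<close> itself needs at most two colours, so let \<open>\<chi> \<ge> 3\<close>. The vertices are
  the \<open>k\<close>-subsets of \<open>{0, \<dots>, n - 1}\<close> without two consecutive elements, where \<open>n = 2k + 2\<chi> - 3\<close> and
  \<open>k\<close> is large. The arcs of \<open>T\<^sub>1\<close> follow a linear order, except that they are reversed on the pairs
  of disjoint sets, the edges of the stable Kneser graph \<open>G\<close>. Two properties of \<open>G\<close> are played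
  against each other.

  First, \<open>G\<close> has no proper colouring with \<open>2\<chi> - 2\<close> colours (\<open>stable_kneser_not_colourable\<close>). As \<open>G\<close>
  has no triangles, every transitive set of \<open>T\<^sub>1\<close> is the union of two independent sets of \<open>G\<close>
  (\<open>proper_colouring_of_transitive_colouring\<close>), so \<open>T\<^sub>1\<close> needs at least \<open>\<chi>\<close> colours. The bound for \<open>G\<close>
  is topological. It follows from Tucker's lemma for the barycentric subdivision of the boundary of
  a cross-polytope, which is obtained here from Fan's parity theorem (\<open>odd_card_alternating_flags\<close>)
  by double counting.

  Second, \<open>G\<close> is nearly bipartite. Call \<open>i\<close> a gap of \<open>A\<close> if neither \<open>i\<close> nor \<open>i - 1\<close> belongs to \<open>A\<close>.
  A vertex has at most \<open>d = 2\<chi> - 2\<close> gaps and is determined by them, so there are at most \<open>(n + 1)\<^sup>d\<close>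
  vertices. The vertices without a gap at \<open>i\<close> all contain \<open>i\<close> or \<open>i - 1\<close>; they form two intersecting
  families and are therefore covered by two transitive sets of \<open>T\<^sub>1\<close>. It remains to choose \<open>T\<^sub>2\<close> so
  that every small \<open>U\<close> has a position \<open>i\<close> such that all vertices with a gap at \<open>i\<close> have arcs to all
  vertices of \<open>U\<close>. By a random construction there is a tournament \<open>R\<close> on the positions in which every
  set of at most \<open>ln (n + 1) / 2\<close> positions is dominated by a single \<open>i\<close>
  (\<open>eventually_dominating_relation\<close>). Let
  \<open>T\<^sub>2\<close> have an arc from \<open>w\<close> to \<open>u\<close> whenever some gap of \<open>w\<close> dominates all gaps of \<open>u\<close> in \<open>R\<close>; asymmetry
  of \<open>R\<close> makes this consistent. The vertices of \<open>U\<close> have at most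
  \<open>d |U| \<le> d\<^sup>2 ln (n + 1) / (8\<chi>\<^sup>2) \<le> ln (n + 1) / 2\<close> gaps together, and an \<open>i\<close> that dominates them is as
  required.

  To have chromatic number exactly \<open>\<chi>\<close>, everything is restricted to a minimal set of vertices that
  is not \<open>(\<chi> - 1)\<close>-colourable. It is still large: it meets the set of vertices with a gap at \<open>i\<close>
  for each of the \<open>n\<close> positions \<open>i\<close>, and each vertex has at most \<open>d\<close> gaps.
\<close>

section \<open>Chromatic numbers and colourings\<close>

text \<open>
  Colourings are stated for a vertex set and an arc relation separately: the sets of interest all lie
  in one ambient tournament, and no induced subgraph has to be formed for them.
\<close>

definition transitively_colourable :: "'a set \<Rightarrow> 'a rel \<Rightarrow> nat \<Rightarrow> bool" where
  "transitively_colourable S E k \<longleftrightarrow>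
    (\<exists>f :: 'a \<Rightarrow> nat. (\<forall>v\<in>S. f v < k) \<and> (\<forall>c. trans (E \<inter> {v\<in>S. f v = c} \<times> {v\<in>S. f v = c})))"

lemma trans_Int_Times:
  assumes "trans E" shows "trans (E \<inter> A \<times> A)"
  using assms unfolding trans_def by blast

lemma arcs_ends_induce_subgraph: "arcs_ends (G \<restriction> S) = arcs_ends G \<inter> S \<times> S"
  by (auto simp: arcs_ends_conv)

lemma transitive_induce_iff:
  "transitive_digraph (G \<restriction> S) \<longleftrightarrow> trans (arcs_ends G \<inter> S \<times> S)"
  by (simp add: transitive_digraph_def arcs_ends_induce_subgraph)

lemma transitively_colourable_mono:
  assumes "transitively_colourable S E k" "S' \<subseteq> S" "k \<le> k'"
  shows "transitively_colourable S' E k'"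
proof -
  obtain f where f: "\<forall>v\<in>S. f v < k" "\<And>c. trans (E \<inter> {v\<in>S. f v = c} \<times> {v\<in>S. f v = c})"
    using assms(1) unfolding transitively_colourable_def by blast
  have "trans (E \<inter> {v\<in>S'. f v = c} \<times> {v\<in>S'. f v = c})" for c
  proof -
    have "E \<inter> {v\<in>S'. f v = c} \<times> {v\<in>S'. f v = c} =
        (E \<inter> {v\<in>S. f v = c} \<times> {v\<in>S. f v = c}) \<inter> S' \<times> S'"
      using assms(2) by blast
    then show ?thesis using trans_Int_Times[OF f(2)] by simp
  qed
  moreover have "\<forall>v\<in>S'. f v < k'" using f(1) assms(2,3) by (meson less_le_trans subsetD)
  ultimately show ?thesis unfolding transitively_colourable_def by blast
qed

text \<open>
  The colour classes of a colouring may be empty, the parts of a partition may not; this is why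
  the bridge between the two is an inequality. Singletons are transitive, so that the minimum in the
  definition of the chromatic number is attained.
\<close>

lemma chromatic_number_le_iff:
  assumes fin: "finite (verts G)"
  shows "chromatic_number G \<le> k \<longleftrightarrow> transitively_colourable (verts G) (arcs_ends G) k"
proof -
  let ?V = "verts G" and ?E = "arcs_ends G"
  let ?good = "\<lambda>k P. partition_on ?V P \<and> card P = k \<and> (\<forall>S\<in>P. transitive_digraph (G \<restriction> S))"
  have colouring_of_partition: "transitively_colourable ?V ?E (card P)" if P: "?good (card P) P" for P
  proof -
    have finP: "finite P" using P finite_elements[OF fin] by blast
    obtain h where h: "bij_betw h P {..<card P}"
      using finP by (metis bij_betw_iff_card card_lessThan finite_lessThan)
    define part where "part v = (THE S. S \<in> P \<and> v \<in> S)" for v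
    have part: "part v \<in> P \<and> v \<in> part v" if "v \<in> ?V" for v
    proof -
      have "\<exists>!S. S \<in> P \<and> v \<in> S" using P that unfolding partition_on_def disjoint_def by blast
      then show ?thesis unfolding part_def by (rule theI')
    qed
    have "trans (?E \<inter> {v\<in>?V. h (part v) = c} \<times> {v\<in>?V. h (part v) = c})" for c
    proof (cases "\<exists>v\<in>?V. h (part v) = c")
      case False
      then have "{v\<in>?V. h (part v) = c} = {}" by blast
      then show ?thesis by (simp only: Sigma_empty1 Int_empty_right) (simp add: trans_def)
    next
      case True
      then obtain u where u: "u \<in> ?V" "h (part u) = c" by blast
      have "v \<in> part u" if "v \<in> ?V" "h (part v) = c" for v
        using h part[OF that(1)] part[OF u(1)] that u(2)
        by (metis bij_betw_imp_inj_on inj_onD)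
      then have eq: "?E \<inter> {v\<in>?V. h (part v) = c} \<times> {v\<in>?V. h (part v) = c} =
          (?E \<inter> part u \<times> part u) \<inter> {v\<in>?V. h (part v) = c} \<times> {v\<in>?V. h (part v) = c}"
        by blast
      have "trans (?E \<inter> part u \<times> part u)"
        using P part[OF u(1)] by (simp add: transitive_induce_iff)
      then show ?thesis by (subst eq) (rule trans_Int_Times)
    qed
    moreover have "\<forall>v\<in>?V. h (part v) < card P"
      using h part by (metis bij_betwE lessThan_iff)
    ultimately show ?thesis unfolding transitively_colourable_def by (intro exI[of _ "h \<circ> part"]) simp
  qed
  have partition_of_colouring: "\<exists>P. ?good (card P) P \<and> card P \<le> k"
    if "transitively_colourable ?V ?E k" for k
  proof -
    obtain f where f: "\<forall>v\<in>?V. f v < k" "\<And>c. trans (?E \<inter> {v\<in>?V. f v = c} \<times> {v\<in>?V. f v = c})"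
      using \<open>transitively_colourable ?V ?E k\<close> unfolding transitively_colourable_def by blast
    define P where "P = (\<lambda>c. {v\<in>?V. f v = c}) ` (f ` ?V)"
    have "partition_on ?V P"
      unfolding P_def by (rule partition_onI) (auto simp: disjnt_def)
    moreover have "\<forall>S\<in>P. transitive_digraph (G \<restriction> S)"
      unfolding P_def transitive_induce_iff using f(2) by blast
    moreover have "card P \<le> k"
    proof -
      have "card P \<le> card (f ` ?V)" unfolding P_def using fin by (intro card_image_le) auto
      also have "\<dots> \<le> card {..<k}" using f(1) by (intro card_mono) auto
      finally show ?thesis by simp
    qed
    ultimately show ?thesis by blast
  qed
  obtain P0 where P0: "?good (card P0) P0"
  proof
    show "?good (card ((\<lambda>v. {v}) ` ?V)) ((\<lambda>v. {v}) ` ?V)"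
    proof (intro conjI refl)
      show "partition_on ?V ((\<lambda>v. {v}) ` ?V)" by (rule partition_onI) (auto simp: disjnt_def)
      show "\<forall>S\<in>(\<lambda>v. {v}) ` ?V. transitive_digraph (G \<restriction> S)"
        unfolding transitive_induce_iff by (auto simp: trans_def)
    qed
  qed
  have "\<exists>P. ?good (chromatic_number G) P"
    unfolding chromatic_number_def by (rule LeastI[of _ "card P0"]) (rule exI[of _ P0], rule P0)
  then obtain P where P: "?good (chromatic_number G) P" by (rule exE)
  then have "transitively_colourable ?V ?E (chromatic_number G)"
    using colouring_of_partition[of P] by simp
  moreover have "chromatic_number G \<le> k" if col: "transitively_colourable ?V ?E k"
  proof -
    obtain P where P: "?good (card P) P" "card P \<le> k" using partition_of_colouring[OF col] by blast
    have "chromatic_number G \<le> card P" unfolding chromatic_number_def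
      by (rule Least_le) (rule exI[of _ P], rule P(1))
    with P show ?thesis by simp
  qed
  ultimately show ?thesis using transitively_colourable_mono[OF _ order_refl] by metis
qed

lemma transitively_colourable_insert:
  assumes "transitively_colourable (S - {v}) E k"
  shows "transitively_colourable S E (Suc k)"
proof -
  obtain f where f: "\<forall>u\<in>S - {v}. f u < k"
      "\<And>c. trans (E \<inter> {u\<in>S - {v}. f u = c} \<times> {u\<in>S - {v}. f u = c})"
    using assms unfolding transitively_colourable_def by blast
  let ?g = "f(v := k)"
  have "trans (E \<inter> {u\<in>S. ?g u = c} \<times> {u\<in>S. ?g u = c})" for c
  proof (cases "c = k")
    case True
    then have "{u\<in>S. ?g u = c} \<subseteq> {v}" using f(1) by auto
    then show ?thesis by (auto simp: trans_def)
  next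
    case False
    then have "{u\<in>S. ?g u = c} = {u\<in>S - {v}. f u = c}" by auto
    then show ?thesis using f(2)[of c] by (simp only:)
  qed
  moreover have "\<forall>u\<in>S. ?g u < Suc k" using f(1) by (simp add: less_Suc_eq)
  ultimately show ?thesis unfolding transitively_colourable_def by blast
qed

text \<open>
  A minimal subset that is not \<open>k\<close>-colourable works, because one vertex can always be given a new
  colour of its own.
\<close>

lemma exists_critical_subset:
  assumes "finite S" "\<not> transitively_colourable S E k"
  obtains S' where "S' \<subseteq> S" "\<not> transitively_colourable S' E k" "transitively_colourable S' E (Suc k)"
proof -
  let ?Q = "{S'. S' \<subseteq> S \<and> \<not> transitively_colourable S' E k}"
  have "finite ?Q" "S \<in> ?Q" using assms by auto
  then obtain S' where S': "S' \<in> ?Q" and minimal: "\<And>B. B \<in> ?Q \<Longrightarrow> B \<subseteq> S' \<Longrightarrow> B = S'"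
    using finite_has_minimal[of ?Q] by (metis (no_types, lifting) empty_iff)
  have "S' \<noteq> {}" using S' by (auto simp: transitively_colourable_def)
  then obtain v where "v \<in> S'" by blast
  then have "transitively_colourable (S' - {v}) E k" using S' minimal[of "S' - {v}"] by blast
  then have "transitively_colourable S' E (Suc k)" by (rule transitively_colourable_insert)
  then show thesis using S' by (intro that) auto
qed

section \<open>Tournaments with a given backedge graph\<close>

lemma tournament_with_proj:
  assumes "finite V" "\<And>u. \<not> E u u" "\<And>u v. u \<in> V \<Longrightarrow> v \<in> V \<Longrightarrow> u \<noteq> v \<Longrightarrow> E u v \<longleftrightarrow> \<not> E v u"
  shows "tournament (with_proj \<lparr>pverts = V, parcs = {(u, v). u \<in> V \<and> v \<in> V \<and> E u v}\<rparr>)"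
proof -
  let ?T = "\<lparr>pverts = V, parcs = {(u, v). u \<in> V \<and> v \<in> V \<and> E u v}\<rparr>"
  have "parcs ?T \<subseteq> V \<times> V" by auto
  then have "finite (parcs ?T)" using assms(1) by (meson finite_SigmaI finite_subset)
  then have "pair_digraph ?T"
    using assms(1,2) by (unfold_locales) (auto split: prod.splits)
  then interpret pair_digraph ?T .
  show ?thesis
  proof unfold_locales
    fix u v
    assume "u \<in> verts (with_proj ?T)" "v \<in> verts (with_proj ?T)" "u \<noteq> v"
    then show "(u \<rightarrow>\<^bsub>with_proj ?T\<^esub> v) \<longleftrightarrow> \<not> (v \<rightarrow>\<^bsub>with_proj ?T\<^esub> u)"
      using assms(3)[of u v] by simp
  qed
qed

text \<open>
  In the usual terminology, \<open>adj\<close> is the backedge graph of the tournament with respect to the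
  linear order of the vertices.
\<close>

definition backedge_arc :: "('a::linorder \<Rightarrow> 'a \<Rightarrow> bool) \<Rightarrow> 'a \<Rightarrow> 'a \<Rightarrow> bool" where
  "backedge_arc adj u v \<longleftrightarrow> u < v \<and> \<not> adj u v \<or> v < u \<and> adj u v"

definition backedge_digraph :: "'a::linorder set \<Rightarrow> ('a \<Rightarrow> 'a \<Rightarrow> bool) \<Rightarrow> 'a pair_pre_digraph" where
  "backedge_digraph V adj = \<lparr>pverts = V, parcs = {(u, v). u \<in> V \<and> v \<in> V \<and> backedge_arc adj u v}\<rparr>"

lemma tournament_backedge_digraph:
  assumes "finite V" "symp adj"
  shows "tournament (with_proj (backedge_digraph V adj))"
  unfolding backedge_digraph_def using assms
  by (intro tournament_with_proj) (auto simp: backedge_arc_def symp_def)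

lemma pverts_backedge_digraph [simp]: "pverts (backedge_digraph V adj) = V"
  by (simp add: backedge_digraph_def)

definition backedge_rel :: "('a::linorder \<Rightarrow> 'a \<Rightarrow> bool) \<Rightarrow> 'a rel" where
  "backedge_rel adj = {(u, v). backedge_arc adj u v}"

lemma transitively_colourable_restrict:
  assumes "S \<subseteq> V" shows "transitively_colourable S (E \<inter> V \<times> V) k \<longleftrightarrow> transitively_colourable S E k"
proof -
  have "E \<inter> V \<times> V \<inter> {v\<in>S. P v} \<times> {v\<in>S. P v} = E \<inter> {v\<in>S. P v} \<times> {v\<in>S. P v}" for P
    using assms by blast
  then show ?thesis by (simp add: transitively_colourable_def)
qed

lemma parcs_backedge_digraph: "parcs (backedge_digraph V adj) = backedge_rel adj \<inter> V \<times> V"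
  by (auto simp: backedge_digraph_def backedge_rel_def)

lemma chromatic_number_backedge_le_iff:
  assumes "finite V"
  shows "chromatic_number (with_proj (backedge_digraph V adj)) \<le> k \<longleftrightarrow>
    transitively_colourable V (backedge_rel adj) k"
  using chromatic_number_le_iff[of "with_proj (backedge_digraph V adj)"] assms
  by (simp add: parcs_backedge_digraph transitively_colourable_restrict)

lemma chromatic_number_induced_backedge_le_iff:
  assumes "finite V" "S \<subseteq> V"
  shows "chromatic_number (with_proj (backedge_digraph V adj) \<restriction> S) \<le> k \<longleftrightarrow>
    transitively_colourable S (backedge_rel adj) k"
proof -
  have "finite S" using assms finite_subset by blast
  then have "chromatic_number (with_proj (backedge_digraph V adj) \<restriction> S) \<le> k \<longleftrightarrow>
      transitively_colourable S (backedge_rel adj \<inter> V \<times> V \<inter> S \<times> S) k"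
    using chromatic_number_le_iff[of "with_proj (backedge_digraph V adj) \<restriction> S"]
    by (simp add: arcs_ends_induce_subgraph parcs_backedge_digraph)
  then show ?thesis using assms(2) by (simp add: transitively_colourable_restrict)
qed

text \<open>
  On an independent set of the backedge graph the tournament coincides with the linear order.
\<close>

lemma transitively_colourable_backedge:
  assumes "symp adj" "\<And>v. v \<in> S \<Longrightarrow> f v < k"
    and "\<And>u v. u \<in> S \<Longrightarrow> v \<in> S \<Longrightarrow> adj u v \<Longrightarrow> f u \<noteq> f v"
  shows "transitively_colourable S (backedge_rel adj) k"
  unfolding transitively_colourable_def
proof (intro exI[of _ f] conjI ballI allI)
  fix c
  have eq: "backedge_rel adj \<inter> {v\<in>S. f v = c} \<times> {v\<in>S. f v = c} =
      {(u, v). u \<in> {v\<in>S. f v = c} \<and> v \<in> {v\<in>S. f v = c} \<and> u < v}"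
  proof -
    have "\<not> adj u v" if "u \<in> S" "v \<in> S" "f u = c" "f v = c" for u v
      using assms(3)[OF that(1,2)] that(3,4) by auto
    then show ?thesis unfolding backedge_rel_def backedge_arc_def by blast
  qed
  show "trans (backedge_rel adj \<inter> {v\<in>S. f v = c} \<times> {v\<in>S. f v = c})"
    unfolding eq trans_def by (blast intro: less_trans)
qed (use assms(2) in auto)

text \<open>
  Let \<open>t < u < v\<close> belong to one transitive class, with \<open>t u\<close> and \<open>u v\<close> adjacent. Then there are arcs from \<open>v\<close>
  to \<open>u\<close> and from \<open>u\<close> to \<open>t\<close>, so there is one from \<open>v\<close> to \<open>t\<close>, which makes \<open>t u v\<close> a triangle. Without
  triangles, no vertex therefore has both a smaller and a larger neighbour in its class, and the
  class splits into two independent sets according to whether a smaller neighbour exists.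
\<close>

lemma proper_colouring_of_transitive_colouring:
  assumes "symp adj"
    and triangle_free: "\<And>u v w. u \<in> S \<Longrightarrow> v \<in> S \<Longrightarrow> w \<in> S \<Longrightarrow> adj u v \<Longrightarrow> adj v w \<Longrightarrow> \<not> adj u w"
    and irrefl: "\<And>v. v \<in> S \<Longrightarrow> \<not> adj v v"
    and "transitively_colourable S (backedge_rel adj) k"
  shows "\<exists>g :: 'a::linorder \<Rightarrow> nat. (\<forall>v\<in>S. g v < 2 * k) \<and> (\<forall>u\<in>S. \<forall>v\<in>S. adj u v \<longrightarrow> g u \<noteq> g v)"
proof -
  let ?E = "backedge_rel adj"
  obtain f where f: "\<forall>v\<in>S. f v < k" "\<And>c. trans (?E \<inter> {v\<in>S. f v = c} \<times> {v\<in>S. f v = c})"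
    using assms(4) unfolding transitively_colourable_def by blast
  define low where "low v \<longleftrightarrow> (\<exists>u\<in>S. f u = f v \<and> u < v \<and> adj u v)" for v
  define g where "g v = 2 * f v + (if low v then 1 else 0)" for v
  have sym: "adj v u" if "adj u v" for u v using assms(1) that by (auto simp: symp_def)
  have no_path: False
    if tuv: "t \<in> S" "u \<in> S" "v \<in> S" "t < u" "u < v" "adj t u" "adj u v" "f t = f u" "f u = f v" for t u v
  proof -
    have "(v, u) \<in> ?E \<inter> {w\<in>S. f w = f v} \<times> {w\<in>S. f w = f v}"
      using tuv sym by (auto simp: backedge_rel_def backedge_arc_def)
    moreover have "(u, t) \<in> ?E \<inter> {w\<in>S. f w = f v} \<times> {w\<in>S. f w = f v}"
      using tuv sym by (auto simp: backedge_rel_def backedge_arc_def)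
    ultimately have "(v, t) \<in> ?E \<inter> {w\<in>S. f w = f v} \<times> {w\<in>S. f w = f v}"
      using f(2)[of "f v"] by (rule transD[rotated])
    then have "adj v t" using tuv by (auto simp: backedge_rel_def backedge_arc_def)
    then show False using triangle_free[of t u v] tuv sym by blast
  qed
  have proper: False if "u \<in> S" "v \<in> S" "adj u v" "g u = g v" "u < v" for u v
  proof -
    have fuv: "f u = f v" and low: "low u \<longleftrightarrow> low v"
      using \<open>g u = g v\<close> unfolding g_def by (auto split: if_splits) presburger+
    have "low v" using that fuv unfolding low_def by blast
    then obtain t where "t \<in> S" "f t = f u" "t < u" "adj t u" using low unfolding low_def by blast
    then show False using no_path that fuv by blast
  qed
  show ?thesis
  proof (intro exI[of _ g] conjI ballI impI)
    show "g v < 2 * k" if "v \<in> S" for v using f(1) that unfolding g_def by fastforce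
    show "g u \<noteq> g v" if "u \<in> S" "v \<in> S" "adj u v" for u v
      using proper[of u v] proper[of v u] that sym[of u v] irrefl[of u] by (cases u v rule: linorder_cases) auto
  qed
qed

section \<open>Fan's parity theorem for the cross-polytope\<close>

fun alternating :: "bool \<Rightarrow> bool list \<Rightarrow> bool" where
  "alternating b [] \<longleftrightarrow> True"
| "alternating b (x # xs) \<longleftrightarrow> x = b \<and> alternating (\<not> b) xs"

lemma alternating_exclusive: "xs \<noteq> [] \<Longrightarrow> \<not> (alternating True xs \<and> alternating False xs)"
  by (cases xs) auto

lemma alternating_nth_Suc: "alternating b xs \<Longrightarrow> Suc i < length xs \<Longrightarrow> xs ! Suc i \<longleftrightarrow> \<not> xs ! i"
proof (induction xs arbitrary: b i)
  case (Cons x xs)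
  then show ?case by (cases i; cases xs) auto
qed simp

lemma alternating_map_Not: "alternating b (map Not xs) \<longleftrightarrow> alternating (\<not> b) xs"
  by (induction xs arbitrary: b) auto

text \<open>
  This is the combinatorial core of Fan's theorem. From an alternating sequence that starts with \<open>b\<close>,
  only the deletion of the last entry leaves an alternating sequence that starts with \<open>b\<close> or is empty;
  if it starts with the other sign, only the deletion of the first entry does. In a sequence that is not
  alternating, the number of successful deletions is zero or two: the sequence must have a
  unique place where equal signs are adjacent, and either of these two entries can be deleted.
\<close>

lemma odd_card_alternating_deletions_list:
  "xs \<noteq> [] \<Longrightarrow> odd (card {r. r < length xs \<and> alternating b (take r xs @ drop (Suc r) xs)}) \<longleftrightarrow>
    alternating b xs \<or> alternating (\<not> b) xs"
proof (induction xs arbitrary: b)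
  case Nil
  then show ?case by simp
next
  case (Cons x xs)
  let ?D = "\<lambda>b xs. {r. r < length xs \<and> alternating b (take r xs @ drop (Suc r) xs)}"
  have D: "?D b (x # xs) = (if alternating b xs then {0} else {}) \<union> (if x = b then Suc ` ?D (\<not> b) xs else {})"
    (is "_ = ?R")
  proof (rule set_eqI)
    fix r
    show "r \<in> ?D b (x # xs) \<longleftrightarrow> r \<in> ?R" by (cases r) auto
  qed
  have card: "card (?D b (x # xs)) = of_bool (alternating b xs) + (if x = b then card (?D (\<not> b) xs) else 0)"
    unfolding D by (subst card_Un_disjoint) (auto simp: card_image)
  show ?case
  proof (cases "xs = []")
    case True
    then show ?thesis unfolding card by auto
  next
    case False
    then have "odd (card (?D (\<not> b) xs)) \<longleftrightarrow> alternating (\<not> b) xs \<or> alternating b xs"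
      using Cons.IH[of "\<not> b"] by simp
    moreover have "\<not> (alternating b xs \<and> alternating (\<not> b) xs)"
      using alternating_exclusive[OF False] by (cases b) auto
    ultimately show ?thesis unfolding card by (cases "x = b"; cases "alternating b xs") auto
  qed
qed

text \<open>
  Labels are nonzero integers in the literature. Here the number \<open>2 * j + s\<close> with \<open>s \<in> {0, 1}\<close> encodes
  the integer of absolute value \<open>j + 1\<close> that is positive if \<open>s = 1\<close> and negative if \<open>s = 0\<close>, so that sorting
  the codes sorts the integers by absolute value and \<^const>\<open>odd\<close> reads off the sign.
\<close>

definition alternating_labels :: "bool \<Rightarrow> nat multiset \<Rightarrow> bool" where
  "alternating_labels b M \<longleftrightarrow> alternating b (map odd (sorted_list_of_multiset M))"

lemma odd_card_alternating_deletions: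
  assumes "finite J" "J \<noteq> {}"
  shows "odd (card {r\<in>J. alternating_labels b (image_mset f (mset_set (J - {r})))}) \<longleftrightarrow>
    alternating_labels b (image_mset f (mset_set J)) \<or> alternating_labels (\<not> b) (image_mset f (mset_set J))"
proof -
  define M where "M = image_mset f (mset_set J)"
  define xs where "xs = sorted_list_of_multiset M"
  define P where "P x \<longleftrightarrow> alternating_labels b (M - {#x#})" for x
  have xs: "mset xs = M" "sorted xs" unfolding xs_def by simp_all
  have "xs \<noteq> []" using assms xs(1) unfolding M_def by (auto simp: mset_set_empty_iff)
  have delete: "image_mset f (mset_set (J - {r})) = M - {#f r#}" if "r \<in> J" for r
    using that assms(1) unfolding M_def by (simp add: mset_set_Diff image_mset_Diff)
  have "card {r\<in>J. alternating_labels b (image_mset f (mset_set (J - {r})))} = card {r\<in>J. P (f r)}"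
    unfolding P_def using delete by (metis (no_types, lifting))
  also have "\<dots> = size (filter_mset P M)"
    unfolding M_def using assms(1) by (simp add: filter_mset_image_mset)
  also have "\<dots> = length (filter P xs)" unfolding xs(1)[symmetric] by (simp flip: mset_filter)
  also have "\<dots> = card {r. r < length xs \<and> P (xs ! r)}" by (rule length_filter_conv_card)
  also have "{r. r < length xs \<and> P (xs ! r)} =
      {r. r < length (map odd xs) \<and> alternating b (take r (map odd xs) @ drop (Suc r) (map odd xs))}"
  proof -
    have "sorted_list_of_multiset (M - {#xs ! r#}) = take r xs @ drop (Suc r) xs" if "r < length xs" for r
    proof -
      have "mset xs = mset (take r xs @ xs ! r # drop (Suc r) xs)"
        using that by (simp add: id_take_nth_drop[symmetric])
      then have "M - {#xs ! r#} = mset (take r xs @ drop (Suc r) xs)" unfolding xs(1) by simp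
      moreover have "sorted (take r xs @ drop (Suc r) xs)"
      proof -
        have "sorted (take r xs @ xs ! r # drop (Suc r) xs)"
          using that xs(2) by (simp add: id_take_nth_drop[symmetric])
        then show ?thesis by (auto simp: sorted_append)
      qed
      ultimately show ?thesis by (metis sorted_list_of_multiset_mset sorted_sort_id)
    qed
    then show ?thesis unfolding P_def alternating_labels_def by (auto simp: take_map drop_map)
  qed
  finally show ?thesis
    using odd_card_alternating_deletions_list[of "map odd xs" b] \<open>xs \<noteq> []\<close>
    by (simp add: alternating_labels_def xs_def M_def)
qed

definition opposite_label :: "nat \<Rightarrow> nat" where
  "opposite_label c = (if even c then c + 1 else c - 1)"

lemma odd_opposite_label [simp]: "odd (opposite_label c) \<longleftrightarrow> even c"
  by (auto simp: opposite_label_def)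

lemma opposite_label_involution [simp]: "opposite_label (opposite_label c) = c"
  by (auto simp: opposite_label_def)

lemma opposite_label_less:
  assumes "x < y" "y \<noteq> opposite_label x"
  shows "opposite_label x < opposite_label y"
  using assms unfolding opposite_label_def by (auto elim!: evenE oddE)

text \<open>
  Changing all signs could exchange only the codes \<open>2 * j\<close> and \<open>2 * j + 1\<close> in the sorted order, and
  the hypothesis excludes that both of them occur.
\<close>

lemma alternating_labels_opposite:
  assumes "\<And>x y. x \<in># M \<Longrightarrow> y \<in># M \<Longrightarrow> x \<noteq> opposite_label y"
  shows "alternating_labels b (image_mset opposite_label M) \<longleftrightarrow> alternating_labels (\<not> b) M"
proof -
  define xs where "xs = sorted_list_of_multiset M"
  have xs: "mset xs = M" "sorted xs" unfolding xs_def by simp_all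
  have no_opposite: "\<And>x y. x \<in> set xs \<Longrightarrow> y \<in> set xs \<Longrightarrow> x \<noteq> opposite_label y"
    using assms unfolding xs(1)[symmetric] by auto
  have "sorted_wrt (\<lambda>x y. opposite_label x \<le> opposite_label y) xs"
    using xs(2)
  proof (rule sorted_wrt_mono_rel[rotated])
    fix x y assume "x \<in> set xs" "y \<in> set xs" "x \<le> y"
    then show "opposite_label x \<le> opposite_label y"
      using opposite_label_less[of x y] no_opposite[of y x] by (cases "x = y") auto
  qed
  then have "sorted (map opposite_label xs)" by (simp add: sorted_map)
  then have "sorted_list_of_multiset (image_mset opposite_label M) = map opposite_label xs"
    unfolding xs(1)[symmetric] by (simp add: sorted_sort_id flip: mset_map)
  moreover have "map odd (map opposite_label xs) = map Not (map odd xs)" by simp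
  ultimately show ?thesis
    unfolding alternating_labels_def by (metis alternating_map_Not xs_def)
qed

text \<open>
  Consecutive labels of the sorted sequence differ in sign and are not complementary, so their
  absolute values increase strictly.
\<close>

lemma alternating_labels_unbounded:
  assumes "\<And>x y. x \<in># M \<Longrightarrow> y \<in># M \<Longrightarrow> x \<noteq> opposite_label y"
    and "alternating_labels b M" "M \<noteq> {#}"
  obtains x where "x \<in># M" "2 * (size M - 1) \<le> x"
proof -
  define xs where "xs = sorted_list_of_multiset M"
  have xs: "mset xs = M" "sorted xs" unfolding xs_def by simp_all
  have alt: "alternating b (map odd xs)" using assms(2) by (simp add: alternating_labels_def xs_def)
  have "2 * i \<le> xs ! i - xs ! i mod 2" if "i < length xs" for i
    using that
  proof (induction i)
    case (Suc i)
    have "xs ! Suc i \<in># M" "xs ! i \<in># M" using Suc.prems unfolding xs(1)[symmetric] by auto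
    then have "xs ! Suc i \<noteq> opposite_label (xs ! i)" by (rule assms(1))
    moreover have "odd (xs ! Suc i) \<longleftrightarrow> even (xs ! i)"
      using alternating_nth_Suc[OF alt, of i] Suc.prems by simp
    moreover have "xs ! i \<le> xs ! Suc i" using xs(2) Suc.prems by (simp add: sorted_nth_mono)
    ultimately show ?case
      using Suc unfolding opposite_label_def by (auto split: if_splits elim!: evenE oddE) presburger+
  qed simp
  moreover have "xs \<noteq> []" using assms(3) xs(1) by auto
  ultimately have "2 * (length xs - 1) \<le> xs ! (length xs - 1)" by (meson diff_le_self diff_less le_trans length_greater_0_conv zero_less_one)
  moreover have "xs ! (length xs - 1) \<in># M" using \<open>xs \<noteq> []\<close> unfolding xs(1)[symmetric] by simp
  moreover have "size M = length xs" unfolding xs(1)[symmetric] by simp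
  ultimately show thesis using that by simp
qed

lemma even_card_involution:
  assumes "finite A" "\<And>x. x \<in> A \<Longrightarrow> h x \<in> A" "\<And>x. x \<in> A \<Longrightarrow> h (h x) = x" "\<And>x. x \<in> A \<Longrightarrow> h x \<noteq> x"
  shows "even (card A)"
proof -
  have "(\<Sum>x\<in>A. 1 :: bit) = 0"
    by (rule sum_involution_eq_0[where h = h]) (use assms in auto)
  then have "even (of_nat (card A) :: bit)" by simp
  then show ?thesis by (simp only: even_of_nat)
qed

type_synonym signed = "nat \<times> bool"

definition negate :: "signed \<Rightarrow> signed" where
  "negate x = (fst x, \<not> snd x)"

lemma negate_simps [simp]: "negate (negate x) = x" "fst (negate x) = fst x" "snd (negate x) \<longleftrightarrow> \<not> snd x"
    "negate x \<noteq> x" "negate (i, b) = (i, \<not> b)"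
  by (auto simp: negate_def prod_eq_iff)

lemma mem_negate_image: "x \<in> negate ` A \<longleftrightarrow> negate x \<in> A"
  by (metis image_iff negate_simps(1))

text \<open>
  The proper faces of the cross-polytope correspond to the nonzero sign vectors: \<open>(i, True) \<in> X\<close>
  and \<open>(i, False) \<in> X\<close> mean that coordinate \<open>i\<close> is positive or negative, respectively, and a
  coordinate that does not occur in \<open>X\<close> is zero.
\<close>

definition face :: "nat \<Rightarrow> signed set \<Rightarrow> bool" where
  "face n X \<longleftrightarrow> X \<noteq> {} \<and> fst ` X \<subseteq> {..<n} \<and> inj_on fst X"

text \<open>
  A maximal chain of faces adds one signed coordinate at a time. It is stored as the list of these
  coordinates in the order in which they are added; the \<open>j\<close>-th face of the chain is then the set of the
  first \<open>j + 1\<close> entries. These chains are the facets of the barycentric subdivision.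
\<close>

definition flags :: "nat \<Rightarrow> signed list set" where
  "flags n = {ws. distinct (map fst ws) \<and> set (map fst ws) = {..<n}}"

lemma length_flags: "ws \<in> flags n \<Longrightarrow> length ws = n"
  unfolding flags_def using distinct_card[of "map fst ws"] by auto

lemma finite_flags: "finite (flags n)"
proof (rule finite_subset)
  show "flags n \<subseteq> {ws. set ws \<subseteq> {..<n} \<times> UNIV \<and> length ws = n}"
  proof
    fix ws assume ws: "ws \<in> flags n"
    have "fst x < n" if "x \<in> set ws" for x using ws that unfolding flags_def by auto
    then show "ws \<in> {ws. set ws \<subseteq> {..<n} \<times> UNIV \<and> length ws = n}"
      using length_flags[OF ws] by (auto simp: mem_Times_iff)
  qed
  show "finite {ws::signed list. set ws \<subseteq> {..<n} \<times> UNIV \<and> length ws = n}"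
    by (intro finite_lists_length_eq) auto
qed

definition flag_face :: "signed list \<Rightarrow> nat \<Rightarrow> signed set" where
  "flag_face ws j = set (take (Suc j) ws)"

lemma face_flag_face:
  assumes "ws \<in> flags n" "j < n"
  shows "face n (flag_face ws j)"
proof -
  have "inj_on fst (set ws)" using assms(1) by (simp add: flags_def distinct_map)
  moreover have "set (take (Suc j) ws) \<subseteq> set ws" by (rule set_take_subset)
  moreover have "fst ` set ws = {..<n}" using assms(1) by (simp add: flags_def)
  moreover have "take (Suc j) ws \<noteq> []" using assms length_flags by fastforce
  ultimately show ?thesis unfolding face_def flag_face_def
    by (metis image_mono inj_on_subset set_empty)
qed

text \<open>
  These are the hypotheses of Tucker's lemma for the barycentric subdivision of the boundary of the
  cross-polytope, whose vertices are the faces and whose edges are the pairs of nested faces.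
\<close>

locale antipodal_labelling =
  fixes n :: nat and lab :: "signed set \<Rightarrow> nat"
  assumes antipodal: "face n X \<Longrightarrow> lab (negate ` X) = opposite_label (lab X)"
    and no_complementary_edge: "face n X \<Longrightarrow> face n Y \<Longrightarrow> X \<subseteq> Y \<Longrightarrow> lab X \<noteq> opposite_label (lab Y)"
begin

definition labels :: "signed list \<Rightarrow> nat set \<Rightarrow> nat multiset" where
  "labels ws J = image_mset (\<lambda>j. lab (flag_face ws j)) (mset_set J)"

lemma face_mono: "face m X \<Longrightarrow> m \<le> n \<Longrightarrow> face n X"
  by (auto simp: face_def)

lemma flag_face_mono: "i \<le> j \<Longrightarrow> flag_face ws i \<subseteq> flag_face ws j"
  unfolding flag_face_def by (rule set_take_subset_set_take) simp

lemma labels_no_complement: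
  assumes "ws \<in> flags m" "m \<le> n" "J \<subseteq> {..<m}" "x \<in># labels ws J" "y \<in># labels ws J"
  shows "x \<noteq> opposite_label y"
proof -
  have "finite J" using assms(3) finite_subset by blast
  then obtain i j where ij: "i \<in> J" "j \<in> J" "x = lab (flag_face ws i)" "y = lab (flag_face ws j)"
    using assms(4,5) unfolding labels_def by auto
  have face: "face n (flag_face ws i)" if "i \<in> J" for i
    using face_mono[OF face_flag_face[OF assms(1)] assms(2)] that assms(3) by blast
  have sym: "b \<noteq> opposite_label a" if "a \<noteq> opposite_label b" for a b
    using that by auto
  show ?thesis
  proof (cases "i \<le> j")
    case True
    then show ?thesis using no_complementary_edge[OF face face flag_face_mono] ij by simp
  next
    case False
    then show ?thesis using no_complementary_edge[OF face face flag_face_mono, of j i] ij sym by simp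
  qed
qed

lemma negate_flag: "ws \<in> flags m \<Longrightarrow> map negate ws \<in> flags m"
  by (simp add: flags_def o_def image_image)

lemma labels_negate:
  assumes "ws \<in> flags m" "m \<le> n" "J \<subseteq> {..<m}"
  shows "labels (map negate ws) J = image_mset opposite_label (labels ws J)"
proof -
  have "lab (flag_face (map negate ws) j) = opposite_label (lab (flag_face ws j))" if "j \<in> J" for j
  proof -
    have "face n (flag_face ws j)"
      using face_mono[OF face_flag_face[OF assms(1)] assms(2)] that assms(3) by blast
    then show ?thesis using antipodal by (simp add: flag_face_def take_map)
  qed
  moreover have "finite J" using assms(3) finite_subset by blast
  ultimately show ?thesis
    unfolding labels_def by (auto simp: image_mset.compositionality o_def intro!: image_mset_cong)
qed

lemma alternating_labels_negate:
  assumes "ws \<in> flags m" "m \<le> n"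
  shows "alternating_labels b (labels (map negate ws) {..<m}) \<longleftrightarrow> alternating_labels (\<not> b) (labels ws {..<m})"
  unfolding labels_negate[OF assms order_refl]
  using labels_no_complement[OF assms order_refl] by (intro alternating_labels_opposite)

lemma labels_cong:
  assumes "\<And>j. j \<in> J \<Longrightarrow> flag_face ws j = flag_face ws' j"
  shows "labels ws J = labels ws' J"
  unfolding labels_def using assms
  by (cases "finite J") (auto intro!: image_mset_cong)

lemma labels_exclusive:
  assumes "finite J" "J \<noteq> {}"
  shows "\<not> (alternating_labels True (labels ws J) \<and> alternating_labels False (labels ws J))"
proof -
  have "labels ws J \<noteq> {#}" using assms by (simp add: labels_def mset_set_empty_iff)
  then have "sorted_list_of_multiset (labels ws J) \<noteq> []" by (metis mset_sorted_list_of_multiset mset.simps(1))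
  then show ?thesis using alternating_exclusive unfolding alternating_labels_def by blast
qed

text \<open>
  A facet of the subdivision minus its \<open>r\<close>-th vertex is contained in exactly one other facet. It
  arises by exchanging the coordinates that are added in the steps \<open>r\<close> and \<open>r + 1\<close>, or, if the largest
  face is the one that is left out, by changing the sign of the last coordinate.
\<close>

definition adjacent_flag :: "nat \<Rightarrow> signed list \<times> nat \<Rightarrow> signed list \<times> nat" where
  "adjacent_flag m p = (case p of (ws, r) \<Rightarrow>
    (if r < m then ws[r := ws ! Suc r, Suc r := ws ! r] else ws[m := negate (ws ! m)], r))"

text \<open>
  The flags that contain \<open>(m, True)\<close> form a hemisphere. The condition for \<open>r = m\<close> says that \<open>ws\<close>
  without its largest face does not lie on the boundary of this hemisphere, so that the
  neighbouring flag belongs to the hemisphere as well.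
\<close>

lemma adjacent_flag:
  assumes ws: "ws \<in> flags (Suc m)" "(m, True) \<in> set ws" and r: "r \<le> m" "r = m \<Longrightarrow> fst (ws ! m) \<noteq> m"
  obtains ws' where "adjacent_flag m (ws, r) = (ws', r)" "ws' \<in> flags (Suc m)" "(m, True) \<in> set ws'"
    "r = m \<Longrightarrow> fst (ws' ! m) \<noteq> m" "adjacent_flag m (ws', r) = (ws, r)" "ws' \<noteq> ws"
    "\<And>j. j < Suc m \<Longrightarrow> j \<noteq> r \<Longrightarrow> flag_face ws' j = flag_face ws j"
proof -
  have len: "length ws = Suc m" using length_flags[OF ws(1)] .
  show thesis
  proof (cases "r < m")
    case True
    define ws' where "ws' = ws[r := ws ! Suc r, Suc r := ws ! r]"
    have mset: "mset ws' = mset ws" unfolding ws'_def using True len by (intro mset_swap) auto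
    then have "mset (map fst ws') = mset (map fst ws)" by simp
    then have "ws' \<in> flags (Suc m)"
      using ws(1) unfolding flags_def by (metis (mono_tags, lifting) mem_Collect_eq mset_eq_imp_distinct_iff mset_eq_setD)
    moreover have "(m, True) \<in> set ws'" using ws(2) mset by (metis mset_eq_setD)
    moreover have "ws' \<noteq> ws"
    proof
      assume "ws' = ws"
      then have "ws' ! r = ws ! r" by simp
      then have "ws ! Suc r = ws ! r" unfolding ws'_def using True len by simp
      moreover have "distinct ws" using ws(1) by (simp add: flags_def distinct_map)
      ultimately show False using True len by (simp add: nth_eq_iff_index_eq)
    qed
    moreover have "adjacent_flag m (ws', r) = (ws, r)"
      unfolding adjacent_flag_def ws'_def using True len by (auto simp: list_eq_iff_nth_eq nth_list_update)
    moreover have "flag_face ws' j = flag_face ws j" if "j < Suc m" "j \<noteq> r" for j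
    proof (cases "j < r")
      case True
      then show ?thesis unfolding flag_face_def ws'_def by simp
    next
      case False
      then have "Suc r < Suc j" using that by simp
      then have "take (Suc j) ws' = (take (Suc j) ws)[r := take (Suc j) ws ! Suc r, Suc r := take (Suc j) ws ! r]"
        unfolding ws'_def by (simp add: take_update_swap)
      moreover have "mset \<dots> = mset (take (Suc j) ws)"
        using \<open>Suc r < Suc j\<close> that len by (intro mset_swap) auto
      ultimately show ?thesis unfolding flag_face_def by (metis mset_eq_setD)
    qed
    moreover have "adjacent_flag m (ws, r) = (ws', r)" unfolding adjacent_flag_def ws'_def using True by simp
    ultimately show thesis using True by (intro that[of ws']) auto
  next
    case False
    then have [simp]: "r = m" using r(1) by simp
    define ws' where "ws' = ws[m := negate (ws ! m)]"
    have fst: "map fst ws' = map fst ws"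
      unfolding ws'_def using len by (simp add: list_eq_iff_nth_eq nth_list_update)
    then have "ws' \<in> flags (Suc m)" using ws(1) unfolding flags_def mem_Collect_eq fst by blast
    moreover have "(m, True) \<in> set ws'"
    proof -
      obtain i where "i < length ws" "ws ! i = (m, True)" using ws(2) by (metis in_set_conv_nth)
      moreover from this have "i \<noteq> m" using r(2) by auto
      ultimately have "i < length ws'" "ws' ! i = (m, True)" unfolding ws'_def by simp_all
      then show ?thesis by (metis nth_mem)
    qed
    moreover have "fst (ws' ! m) \<noteq> m" using r(2) len unfolding ws'_def by simp
    moreover have "ws' \<noteq> ws"
    proof
      assume "ws' = ws"
      then have "ws' ! m = ws ! m" by simp
      then show False unfolding ws'_def using len by simp
    qed
    moreover have "adjacent_flag m (ws', r) = (ws, r)"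
      unfolding adjacent_flag_def ws'_def using len by simp
    moreover have "flag_face ws' j = flag_face ws j" if "j < Suc m" "j \<noteq> r" for j
      using that unfolding flag_face_def ws'_def by simp
    moreover have "adjacent_flag m (ws, r) = (ws', r)" unfolding adjacent_flag_def ws'_def by simp
    ultimately show thesis by (intro that[of ws']) auto
  qed
qed

text \<open>
  The boundary of the hemisphere consists of the flags of one dimension less.
\<close>

lemma flags_Suc_snoc:
  "{ws \<in> flags (Suc m). ws ! m = (m, True)} = (\<lambda>vs. vs @ [(m, True)]) ` flags m"
proof (intro equalityI subsetI)
  fix ws assume "ws \<in> {ws \<in> flags (Suc m). ws ! m = (m, True)}"
  then have ws: "ws \<in> flags (Suc m)" "ws ! m = (m, True)" by auto
  have len: "length ws = Suc m" using length_flags[OF ws(1)] .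
  then have eq: "ws = take m ws @ [(m, True)]"
    using ws(2) by (metis lessI order_refl take_Suc_conv_app_nth take_all)
  have "distinct (map fst (take m ws @ [(m, True)]))" "set (map fst (take m ws @ [(m, True)])) = {..<Suc m}"
    using ws(1) unfolding eq[symmetric] by (simp_all add: flags_def)
  then have "take m ws \<in> flags m" unfolding flags_def by (auto simp: lessThan_Suc)
  then show "ws \<in> (\<lambda>vs. vs @ [(m, True)]) ` flags m" using eq by blast
next
  fix ws assume "ws \<in> (\<lambda>vs. vs @ [(m, True)]) ` flags m"
  then obtain vs where vs: "vs \<in> flags m" "ws = vs @ [(m, True)]" by blast
  then have "ws ! m = (m, True)" using length_flags[OF vs(1)] by (metis nth_append_length)
  moreover have "ws \<in> flags (Suc m)" using vs unfolding flags_def by (auto simp: lessThan_Suc)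
  ultimately show "ws \<in> {ws \<in> flags (Suc m). ws ! m = (m, True)}" by simp
qed

text \<open>
  Fan's theorem, by induction on the dimension. By antipodality, the positively alternating flags of
  the sphere are as many as the positively or negatively alternating flags of a hemisphere. Count the
  pairs of a flag of the hemisphere and an index whose deletion leaves a positively alternating
  sequence of labels. For a single flag the number of indices is odd if and only if the flag alternates. On the
  other hand, a chain with one face missing lies in two flags of the hemisphere unless it is on
  the boundary, where it lies in one. Modulo two, the alternating flags of the hemisphere are
  therefore as many as those of its boundary, which is the sphere of the next lower dimension.
\<close>

lemma odd_card_alternating_flags:
  "m \<le> n \<Longrightarrow> odd (card {ws\<in>flags m. alternating_labels True (labels ws {..<m})})"
proof (induction m)
  case 0
  have "{ws\<in>flags 0. alternating_labels True (labels ws {..<0})} = {[]}"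
    by (auto simp: flags_def labels_def alternating_labels_def)
  then show ?case by simp
next
  case (Suc m)
  let ?alt = "\<lambda>b ws. alternating_labels b (labels ws {..<Suc m})"
  \<comment> \<open>the hemisphere on which the new coordinate is nonnegative\<close>
  define H where "H = {ws\<in>flags (Suc m). (m, True) \<in> set ws}"
  have finH: "finite H" unfolding H_def using finite_flags by simp
  have negate_H: "map negate ws \<in> H \<longleftrightarrow> ws \<notin> H" if "ws \<in> flags (Suc m)" for ws
  proof -
    have "inj_on fst (set ws)" "fst ` set ws = {..<Suc m}" using that by (auto simp: flags_def distinct_map)
    then have "\<not> ((m, True) \<in> set ws \<and> (m, False) \<in> set ws)"
      by (metis Pair_inject fst_conv inj_on_def)
    moreover have "m \<in> fst ` set ws" using \<open>fst ` set ws = {..<Suc m}\<close> by simp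
    then obtain b where "(m, b) \<in> set ws" by auto
    then have "(m, True) \<in> set ws \<or> (m, False) \<in> set ws" by (cases b) auto
    moreover have "(m, True) \<in> negate ` set ws \<longleftrightarrow> (m, False) \<in> set ws"
      by (simp add: mem_negate_image)
    ultimately show ?thesis using that negate_flag[OF that] by (auto simp: H_def)
  qed
  have "card {ws\<in>flags (Suc m). ?alt True ws} = card {ws\<in>H. ?alt True ws \<or> ?alt False ws}"
  proof -
    have "{ws\<in>flags (Suc m). ?alt True ws} =
        {ws\<in>H. ?alt True ws} \<union> {ws\<in>flags (Suc m) - H. ?alt True ws}"
      unfolding H_def by blast
    then have "card {ws\<in>flags (Suc m). ?alt True ws} =
        card {ws\<in>H. ?alt True ws} + card {ws\<in>flags (Suc m) - H. ?alt True ws}"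
      using finH finite_flags by (simp add: card_Un_disjoint Int_def)
    also have "card {ws\<in>flags (Suc m) - H. ?alt True ws} = card {ws\<in>H. ?alt False ws}"
    proof (rule bij_betw_same_card[OF bij_betwI[of "map negate" _ _ "map negate"]])
      show "map negate \<in> {ws\<in>flags (Suc m) - H. ?alt True ws} \<rightarrow> {ws\<in>H. ?alt False ws}"
        using negate_H negate_flag alternating_labels_negate[OF _ Suc.prems] by auto
      show "map negate \<in> {ws\<in>H. ?alt False ws} \<rightarrow> {ws\<in>flags (Suc m) - H. ?alt True ws}"
        using negate_H negate_flag alternating_labels_negate[OF _ Suc.prems] by (auto simp: H_def)
    qed (auto simp: o_def map_idI)
    also have "card {ws\<in>H. ?alt True ws} + card {ws\<in>H. ?alt False ws} =
        card ({ws\<in>H. ?alt True ws} \<union> {ws\<in>H. ?alt False ws})"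
      using finH labels_exclusive[of "{..<Suc m}"] by (intro card_Un_disjoint[symmetric]) auto
    also have "{ws\<in>H. ?alt True ws} \<union> {ws\<in>H. ?alt False ws} = {ws\<in>H. ?alt True ws \<or> ?alt False ws}"
      by blast
    finally show ?thesis .
  qed
  moreover
  define facets where
    "facets ws = {r\<in>{..<Suc m}. alternating_labels True (labels ws ({..<Suc m} - {r}))}" for ws
  have odd_facets: "odd (card (facets ws)) \<longleftrightarrow> ?alt True ws \<or> ?alt False ws" for ws
    unfolding facets_def labels_def 
    using odd_card_alternating_deletions[of "{..<Suc m}" True "\<lambda>j. lab (flag_face ws j)"]
    by (simp add: lessThan_empty_iff)
  define P where "P = (SIGMA ws:H. facets ws)"
  have fin_facets: "finite (facets ws)" for ws unfolding facets_def by simp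
  have finP: "finite P" unfolding P_def using finH fin_facets by blast
  have "even (card P) \<longleftrightarrow> even (card {ws\<in>H. ?alt True ws \<or> ?alt False ws})"
    unfolding P_def using finH fin_facets by (simp add: card_SigmaI even_sum_iff odd_facets)
  moreover
  define boundary where "boundary = {(ws :: signed list, r). r = m \<and> fst (ws ! m) = m}"
  \<comment> \<open>Passing to the neighbouring flag pairs up the incidences away from the boundary.\<close>
  have "even (card (P - boundary))"
  proof (rule even_card_involution[where h = "adjacent_flag m"])
    show "finite (P - boundary)" using finP by simp
    fix p assume p: "p \<in> P - boundary"
    obtain ws r where [simp]: "p = (ws, r)" by (cases p)
    have H: "ws \<in> flags (Suc m)" "(m, True) \<in> set ws" and r: "r \<le> m" "r = m \<Longrightarrow> fst (ws ! m) \<noteq> m"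
      and alt: "alternating_labels True (labels ws ({..<Suc m} - {r}))"
      using p by (auto simp: P_def boundary_def H_def facets_def)
    obtain ws' where ws': "adjacent_flag m (ws, r) = (ws', r)" "ws' \<in> flags (Suc m)" "(m, True) \<in> set ws'"
      "r = m \<Longrightarrow> fst (ws' ! m) \<noteq> m" "adjacent_flag m (ws', r) = (ws, r)" "ws' \<noteq> ws"
      "\<And>j. j < Suc m \<Longrightarrow> j \<noteq> r \<Longrightarrow> flag_face ws' j = flag_face ws j"
      using adjacent_flag[OF H r] by metis
    have "labels ws' ({..<Suc m} - {r}) = labels ws ({..<Suc m} - {r})"
      by (rule labels_cong) (use ws'(7) in auto)
    then show "adjacent_flag m p \<in> P - boundary"
      using ws' alt r by (auto simp: P_def boundary_def H_def facets_def)
    show "adjacent_flag m (adjacent_flag m p) = p" "adjacent_flag m p \<noteq> p" using ws' by auto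
  qed
  moreover have "card (P \<inter> boundary) = card {ws\<in>flags m. alternating_labels True (labels ws {..<m})}"
  proof -
    have labels_snoc: "labels (vs @ [x]) {..<m} = labels vs {..<m}" if "vs \<in> flags m" for vs x
      using length_flags[OF that] by (intro labels_cong) (simp add: flag_face_def)
    have "P \<inter> boundary = (\<lambda>ws. (ws, m)) ` {ws\<in>flags (Suc m). ws ! m = (m, True) \<and> alternating_labels True (labels ws {..<m})}"
    proof -
      have "ws \<in> H \<and> fst (ws ! m) = m \<longleftrightarrow> ws ! m = (m, True)" if "ws \<in> flags (Suc m)" for ws
      proof -
        have "ws ! m \<in> set ws" using length_flags[OF that] by simp
        moreover have "inj_on fst (set ws)" using that by (simp add: flags_def distinct_map)
        ultimately show ?thesis
          using that inj_onD[of fst "set ws" "ws ! m" "(m, True)"] unfolding H_def by auto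
      qed
      then have last: "ws \<in> H \<and> fst (ws ! m) = m \<longleftrightarrow> ws \<in> flags (Suc m) \<and> ws ! m = (m, True)" for ws
        unfolding H_def by blast
      have facet: "m \<in> facets ws \<longleftrightarrow> alternating_labels True (labels ws {..<m})" for ws
      proof -
        have "{..<Suc m} - {m} = {..<m}" by auto
        then show ?thesis by (simp add: facets_def)
      qed
      have "P \<inter> boundary = (\<lambda>ws. (ws, m)) ` {ws. (ws \<in> H \<and> fst (ws ! m) = m) \<and> m \<in> facets ws}"
        unfolding P_def boundary_def by blast
      then show ?thesis unfolding last facet by (simp only: conj_assoc)
    qed
    also have "card \<dots> = card {ws\<in>flags (Suc m). ws ! m = (m, True) \<and> alternating_labels True (labels ws {..<m})}"
      by (rule card_image) (simp add: inj_on_def)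
    also have "{ws\<in>flags (Suc m). ws ! m = (m, True) \<and> alternating_labels True (labels ws {..<m})} =
        {ws\<in>(\<lambda>vs. vs @ [(m, True)]) ` flags m. alternating_labels True (labels ws {..<m})}"
      unfolding flags_Suc_snoc[symmetric] by simp
    also have "\<dots> = (\<lambda>vs. vs @ [(m, True)]) ` {vs\<in>flags m. alternating_labels True (labels vs {..<m})}"
      by (auto simp: labels_snoc)
    also have "card \<dots> = card {vs\<in>flags m. alternating_labels True (labels vs {..<m})}"
      by (rule card_image) (simp add: inj_on_def)
    finally show ?thesis .
  qed
  moreover have "card P = card (P - boundary) + card (P \<inter> boundary)"
    using card_Int_Diff[OF finP, of boundary] by simp
  ultimately show ?case using Suc by simp
qed

text \<open>
  Tucker's lemma: the absolute values of \<open>n\<close> alternating labels are distinct, so one is at least \<open>n\<close>,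
  which in the encoding of labels means \<open>2 * (n - 1)\<close>.
\<close>

lemma exists_large_label:
  assumes "n > 0"
  obtains X where "face n X" "2 * (n - 1) \<le> lab X"
proof -
  have "odd (card {ws\<in>flags n. alternating_labels True (labels ws {..<n})})"
    using odd_card_alternating_flags by simp
  then have "{ws\<in>flags n. alternating_labels True (labels ws {..<n})} \<noteq> {}" by (metis card.empty even_zero)
  then obtain ws where ws: "ws \<in> flags n" "alternating_labels True (labels ws {..<n})" by blast
  have size: "size (labels ws {..<n}) = n" by (simp add: labels_def)
  then have "labels ws {..<n} \<noteq> {#}" using assms by auto
  then obtain x where "x \<in># labels ws {..<n}" "2 * (n - 1) \<le> x"
    using alternating_labels_unbounded[OF labels_no_complement[OF ws(1) order_refl order_refl] ws(2)] size
    by metis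
  then show thesis using that face_flag_face[OF ws(1)] by (auto simp: labels_def)
qed

end

section \<open>Stable Kneser graphs\<close>

definition stable_sets :: "nat \<Rightarrow> nat \<Rightarrow> nat set set" where
  "stable_sets n k = {A. A \<subseteq> {..<n} \<and> card A = k \<and> (\<forall>i. i \<in> A \<longrightarrow> Suc i \<notin> A)}"

definition sign_run :: "bool \<Rightarrow> signed list \<Rightarrow> bool" where
  "sign_run b ws \<longleftrightarrow> sorted_wrt (\<lambda>x y. fst x < fst y) ws \<and> alternating b (map snd ws)"

lemma sign_run_Cons:
  "sign_run b (x # ws) \<longleftrightarrow> (\<forall>y\<in>set ws. fst x < fst y) \<and> snd x = b \<and> sign_run (\<not> b) ws"
  by (auto simp: sign_run_def)

lemma sign_run_Nil [simp]: "sign_run b []"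
  by (simp add: sign_run_def)

lemma sign_run_take: "sign_run b ws \<Longrightarrow> sign_run b (take m ws)"
proof (induction ws arbitrary: b m)
  case (Cons x ws)
  then show ?case by (cases m) (auto simp: sign_run_Cons dest: in_set_takeD)
qed simp

lemma sign_run_negate: "sign_run b (map negate ws) \<longleftrightarrow> sign_run (\<not> b) ws"
  by (induction ws arbitrary: b) (auto simp: sign_run_Cons)

text \<open>
  Between two entries of equal sign there is one of the opposite sign, whose index lies strictly
  between theirs.
\<close>

lemma sign_run_stable:
  assumes "sign_run b ws" "(i, c) \<in> set ws" shows "(Suc i, c) \<notin> set ws"
  using assms
proof (induction ws arbitrary: b rule: induct_list012)
  case (3 x y ws)
  have x: "\<forall>z\<in>set (y # ws). fst x < fst z" "snd x = b" and run: "sign_run (\<not> b) (y # ws)"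
    using "3.prems"(1) unfolding sign_run_Cons[of b x] by auto
  have y: "\<forall>z\<in>set ws. fst y < fst z" "snd y = (\<not> b)" using run unfolding sign_run_Cons[of _ y] by auto
  show ?case
  proof
    assume Suc: "(Suc i, c) \<in> set (x # y # ws)"
    show False
    proof (cases "(i, c) = x")
      case True
      then have "(Suc i, c) \<in> set (y # ws)" using Suc by auto
      moreover have "(Suc i, c) \<noteq> y" using True x(2) y(2) by auto
      ultimately have "(Suc i, c) \<in> set ws" by simp
      then have "fst y < Suc i" using y(1) by fastforce
      moreover have "i < fst y" using x(1) True by fastforce
      ultimately show False by simp
    next
      case False
      then have ic: "(i, c) \<in> set (y # ws)" using "3.prems"(2) by auto
      then have "fst x < i" using x(1) by fastforce
      then have "(Suc i, c) \<in> set (y # ws)" using Suc by auto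
      then show False using "3.IH"(2)[OF run ic] by simp
    qed
  qed
qed (auto simp: sign_run_Cons)

lemma card_sign_run:
  assumes "sign_run b ws" "length ws = 2 * k" shows "card {i. (i, c) \<in> set ws} = k"
  using assms
proof (induction k arbitrary: b ws)
  case (Suc k)
  then obtain x y vs where ws: "ws = x # y # vs"
    by (cases ws; cases "tl ws") auto
  have run: "sign_run b (x # y # vs)" "length vs = 2 * k" using Suc.prems ws by auto
  then have vs: "sign_run b vs" "\<forall>z\<in>set vs. fst x < fst z" "\<forall>z\<in>set vs. fst y < fst z"
    and sgn: "snd x = b" "snd y = (\<not> b)"
    by (auto simp: sign_run_Cons)
  define i where "i = (if c = b then fst x else fst y)"
  have "{j. (j, c) \<in> set ws} = insert i {j. (j, c) \<in> set vs}"
    using sgn unfolding ws i_def by (cases x; cases y; cases b; cases c) auto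
  moreover have "i \<notin> {j. (j, c) \<in> set vs}" using vs(2,3) unfolding i_def by (auto split: if_splits)
  moreover have "finite {j. (j, c) \<in> set vs}"
    by (rule finite_subset[of _ "fst ` set vs"]) force+
  ultimately show ?case using Suc.IH[OF vs(1) run(2)] by simp
qed simp

definition run_length :: "bool \<Rightarrow> signed set \<Rightarrow> nat" where
  "run_length b X = Max (length ` {ws. set ws \<subseteq> X \<and> sign_run b ws})"

lemma face_finite: "face n X \<Longrightarrow> finite X"
  unfolding face_def using finite_imageD[of fst X] finite_subset[of "fst ` X" "{..<n}"] by auto

lemma finite_sign_runs:
  assumes "finite X" shows "finite {ws. set ws \<subseteq> X \<and> sign_run b ws}"
proof (rule finite_subset)
  show "finite {ws. set ws \<subseteq> X \<and> distinct ws}" using assms by (rule finite_subset_distinct)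
  have "distinct ws" if "sorted_wrt (\<lambda>x y. fst x < fst y) ws" for ws :: "signed list"
    using that by (induction ws) auto
  then show "{ws. set ws \<subseteq> X \<and> sign_run b ws} \<subseteq> {ws. set ws \<subseteq> X \<and> distinct ws}"
    by (auto simp: sign_run_def)
qed

lemma run_length_ge:
  assumes "finite X" "set ws \<subseteq> X" "sign_run b ws" shows "length ws \<le> run_length b X"
  unfolding run_length_def using assms finite_sign_runs by (intro Max_ge) auto

lemma run_length_attained:
  assumes "finite X"
  obtains ws where "set ws \<subseteq> X" "sign_run b ws" "length ws = run_length b X"
proof -
  have "run_length b X \<in> length ` {ws. set ws \<subseteq> X \<and> sign_run b ws}"
    unfolding run_length_def
  proof (rule Max_in)
    have "[] \<in> {ws. set ws \<subseteq> X \<and> sign_run b ws}" by simp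
    then show "length ` {ws. set ws \<subseteq> X \<and> sign_run b ws} \<noteq> {}" by blast
  qed (use finite_sign_runs[OF assms] in simp)
  then show thesis using that by auto
qed

lemma run_length_mono:
  assumes "finite Y" "X \<subseteq> Y" shows "run_length b X \<le> run_length b Y"
proof -
  obtain ws where "set ws \<subseteq> X" "sign_run b ws" "length ws = run_length b X"
    using run_length_attained finite_subset[OF assms(2,1)] by metis
  then show ?thesis using run_length_ge[OF assms(1), of ws b] assms(2) by auto
qed

lemma run_length_negate:
  assumes "finite X" shows "run_length b (negate ` X) = run_length (\<not> b) X"
proof -
  have le: "run_length b (negate ` X) \<le> run_length (\<not> b) X" if "finite X" for b X
  proof -
    have "finite (negate ` X)" using that by simp
    then obtain ws where ws: "set ws \<subseteq> negate ` X" "sign_run b ws" "length ws = run_length b (negate ` X)"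
      by (rule run_length_attained)
    have "set (map negate ws) \<subseteq> X" using ws(1) by (auto simp: mem_negate_image)
    moreover have "sign_run (\<not> b) (map negate ws)" using ws(2) by (simp add: sign_run_negate)
    ultimately have "length (map negate ws) \<le> run_length (\<not> b) X" using that by (intro run_length_ge)
    then show ?thesis using ws(3) by simp
  qed
  have "negate ` negate ` X = X" by (simp add: image_image)
  then have "run_length (\<not> b) X \<le> run_length b (negate ` X)"
    using le[of "negate ` X" "\<not> b"] assms by simp
  then show ?thesis using le[OF assms] by (simp add: le_antisym)
qed

text \<open>
  If longest runs of both kinds had equal length, the first entry of the one that starts first could
  be put in front of the other, which would become too long.
\<close>

lemma run_length_neq:
  assumes "face n X" shows "run_length True X \<noteq> run_length False X"
proof
  assume eq: "run_length True X = run_length False X"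
  have fin: "finite X" using assms by (rule face_finite)
  obtain x where "x \<in> X" using assms by (auto simp: face_def)
  then have "1 \<le> run_length (snd x) X"
    using run_length_ge[OF fin, of "[x]" "snd x"] by (simp add: sign_run_Cons)
  then have pos: "1 \<le> run_length b X" for b using eq by (cases b; cases "snd x") auto
  have extend: False
    if ws: "set ws \<subseteq> X" "sign_run b ws" "length ws = run_length b X"
      and vs: "set vs \<subseteq> X" "sign_run (\<not> b) vs" "length vs = run_length (\<not> b) X"
      and le: "fst (hd ws) \<le> fst (hd vs)" for b ws vs
  proof -
    have "ws \<noteq> []" using pos[of b] ws(3) by auto
    then obtain x ws' where [simp]: "ws = x # ws'" by (cases ws) auto
    have "vs \<noteq> []" using pos[of "\<not> b"] vs(3) by auto
    then obtain y vs' where [simp]: "vs = y # vs'" by (cases vs) auto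
    have "x \<in> X" "y \<in> X" "snd x = b" "snd y = (\<not> b)" using ws vs by (auto simp: sign_run_Cons)
    then have "fst x \<noteq> fst y" using assms inj_onD[of fst X x y] unfolding face_def by auto
    then have "fst x < fst y" using le by simp
    then have "sign_run b (x # vs)"
      using vs(2) \<open>snd x = b\<close> by (auto simp: sign_run_Cons)
    then have "length (x # vs) \<le> run_length b X"
      using vs(1) \<open>x \<in> X\<close> by (intro run_length_ge[OF fin]) auto
    then show False using vs(3) eq by (cases b) auto
  qed
  obtain ws where ws: "set ws \<subseteq> X" "sign_run True ws" "length ws = run_length True X"
    using fin by (rule run_length_attained)
  obtain vs where vs: "set vs \<subseteq> X" "sign_run False vs" "length vs = run_length False X"
    using fin by (rule run_length_attained)
  show False
  proof (cases "fst (hd ws) \<le> fst (hd vs)")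
    case True
    then show False using extend[of ws True vs] ws vs by simp
  next
    case False
    then show False using extend[of vs False ws] ws vs by simp
  qed
qed

definition max_run :: "signed set \<Rightarrow> nat" where
  "max_run X = max (run_length True X) (run_length False X)"

lemma max_run_pos: "face n X \<Longrightarrow> 0 < max_run X"
  using run_length_neq[of n X] by (auto simp: max_run_def)

lemma max_run_mono: "finite Y \<Longrightarrow> X \<subseteq> Y \<Longrightarrow> max_run X \<le> max_run Y"
  unfolding max_run_def using run_length_mono[of Y X True] run_length_mono[of Y X False] by linarith

lemma max_run_negate: "finite X \<Longrightarrow> max_run (negate ` X) = max_run X"
  by (simp add: max_run_def run_length_negate max.commute)

definition support :: "bool \<Rightarrow> signed set \<Rightarrow> nat set" where
  "support c X = {i. (i, c) \<in> X}"

lemma support_disjoint: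
  assumes "face n X" shows "support True X \<inter> support False X = {}"
proof -
  have "\<not> ((i, True) \<in> X \<and> (i, False) \<in> X)" for i
    using assms inj_onD[of fst X "(i, True)" "(i, False)"] unfolding face_def by auto
  then show ?thesis unfolding support_def by auto
qed

text \<open>
  Of the first \<open>2 * k\<close> entries of a long run, \<open>k\<close> have either sign, and their indices are not consecutive.
\<close>

lemma stable_set_in_support:
  assumes "face n X" "2 * k \<le> max_run X"
  obtains A where "A \<in> stable_sets n k" "A \<subseteq> support c X"
proof -
  obtain b where "2 * k \<le> run_length b X" using assms(2) unfolding max_run_def by (auto simp: le_max_iff_disj)
  moreover obtain ws where ws: "set ws \<subseteq> X" "sign_run b ws" "length ws = run_length b X"
    using face_finite[OF assms(1)] by (rule run_length_attained)
  ultimately have len: "length (take (2 * k) ws) = 2 * k" by simp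
  define A where "A = {i. (i, c) \<in> set (take (2 * k) ws)}"
  have run: "sign_run b (take (2 * k) ws)" using ws(2) by (rule sign_run_take)
  have sub: "A \<subseteq> support c X" using ws(1) unfolding A_def support_def by (auto dest: in_set_takeD)
  moreover have "support c X \<subseteq> {..<n}" using assms(1) unfolding face_def support_def by force
  ultimately have "A \<in> stable_sets n k"
    using card_sign_run[OF run len, of c] sign_run_stable[OF run] unfolding stable_sets_def A_def by auto
  then show thesis using sub that by blast
qed

lemma opposite_label_of_bool: "opposite_label (2 * a + of_bool P) = 2 * a + of_bool (\<not> P)"
  by (auto simp: opposite_label_def)

lemma code_eq_iff: "(2 * a + of_bool P = 2 * b + (of_bool Q :: nat)) \<longleftrightarrow> a = b \<and> (P \<longleftrightarrow> Q)"
  by (cases P; cases Q) (auto, presburger+)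

text \<open>
  Schrijver's lower bound by Matousek's labelling. Given a colouring without a monochromatic disjoint
  pair, label a sign vector by the length of its longest alternating run and the first sign of that
  run as long as this length is less than \<open>2 * k\<close>. A vector with a longer run contains stable sets in
  its positive and in its negative part, and no colour occurs in both; it is labelled by the largest
  colour that occurs, shifted past the lengths, and by the sign of the part in which it occurs. Both kinds
  of labels are antipodal and admit no complementary edge. Two colours
  occur in a vector of the second kind, so the largest of them is not \<open>0\<close>, and only
  \<open>(2 * k - 1) + (q - 1) < n\<close> absolute values are used, contrary to Tucker's lemma.
\<close>

theorem stable_kneser_not_colourable:
  fixes f :: "nat set \<Rightarrow> nat"
  assumes "1 \<le> q" "1 \<le> k" "q + 2 * k < n + 2"
    and colour: "\<And>A. A \<in> stable_sets n k \<Longrightarrow> f A < q"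
  shows "\<exists>A\<in>stable_sets n k. \<exists>B\<in>stable_sets n k. A \<inter> B = {} \<and> f A = f B"
proof (rule ccontr)
  assume neg: "\<not> ?thesis"
  have proper: "f A \<noteq> f B" if "A \<in> stable_sets n k" "B \<in> stable_sets n k" "A \<inter> B = {}" for A B
    using that neg by blast
  define C where "C c X = f ` {A\<in>stable_sets n k. A \<subseteq> support c X}" for c X
  define top where "top X = Max (C True X \<union> C False X)" for X
  define lab where "lab X = (if max_run X < 2 * k
      then 2 * (max_run X - 1) + of_bool (run_length False X < run_length True X)
      else 2 * (2 * k - 2 + top X) + of_bool (top X \<in> C True X))" for X
  have C_bound: "C c X \<subseteq> {..<q}" for c X unfolding C_def using colour by auto
  have C_finite: "finite (C c X)" for c X using C_bound finite_subset by (metis finite_lessThan)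
  have C_disjoint: "C True X \<inter> C False X = {}" if "face n X" for X
  proof (rule ccontr)
    assume "C True X \<inter> C False X \<noteq> {}"
    then obtain A B where AB: "A \<in> stable_sets n k" "A \<subseteq> support True X" "B \<in> stable_sets n k"
        "B \<subseteq> support False X" "f A = f B"
      unfolding C_def by auto
    then have "A \<inter> B = {}" using support_disjoint[OF that] by blast
    then show False using proper[OF AB(1,3)] AB(5) by simp
  qed
  have C_nonempty: "C c X \<noteq> {}" if "face n X" "\<not> max_run X < 2 * k" for c X
    using stable_set_in_support[OF that(1), of k c] that(2) unfolding C_def by auto
  have C_mono: "C c X \<subseteq> C c Y" if "X \<subseteq> Y" for c X Y
    using that unfolding C_def support_def by auto
  have C_negate: "C c (negate ` X) = C (\<not> c) X" for c X
    unfolding C_def support_def by (simp add: mem_negate_image)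
  have top_in: "top X \<in> C True X \<union> C False X" if "face n X" "\<not> max_run X < 2 * k" for X
    unfolding top_def using C_finite C_nonempty[OF that] by (intro Max_in) auto
  have top_pos: "1 \<le> top X" if X: "face n X" "\<not> max_run X < 2 * k" for X
  proof -
    obtain a b where ab: "a \<in> C True X" "b \<in> C False X" using C_nonempty[OF X] by blast
    then have "a \<noteq> b" using C_disjoint[OF X(1)] by blast
    moreover have "a \<le> top X" "b \<le> top X" unfolding top_def using ab C_finite by (auto intro!: Max_ge)
    ultimately show ?thesis by linarith
  qed
  have lab_short: "lab X = 2 * (max_run X - 1) + of_bool (run_length False X < run_length True X)"
    if "max_run X < 2 * k" for X
    using that by (simp add: lab_def)
  have lab_long: "lab X = 2 * (2 * k - 2 + top X) + of_bool (top X \<in> C True X)"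
    if "\<not> max_run X < 2 * k" for X
    using that by (simp add: lab_def)
  interpret antipodal_labelling n lab
  proof
    fix X assume X: "face n X"
    have fin: "finite X" using X by (rule face_finite)
    show "lab (negate ` X) = opposite_label (lab X)"
    proof (cases "max_run X < 2 * k")
      case True
      then have "max_run (negate ` X) < 2 * k" by (simp add: max_run_negate[OF fin])
      moreover have "run_length True X < run_length False X \<longleftrightarrow> \<not> run_length False X < run_length True X"
        using run_length_neq[OF X] by linarith
      ultimately show ?thesis
        by (simp add: lab_short True opposite_label_of_bool max_run_negate[OF fin] run_length_negate[OF fin]
            del: of_bool_not_iff)
    next
      case False
      have "top (negate ` X) = top X" unfolding top_def C_negate by (simp add: Un_commute)
      moreover have "top X \<in> C False X \<longleftrightarrow> top X \<notin> C True X"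
        using top_in[OF X False] C_disjoint[OF X] by blast
      moreover have "\<not> max_run (negate ` X) < 2 * k" using False by (simp add: max_run_negate[OF fin])
      ultimately have "lab (negate ` X) = 2 * (2 * k - 2 + top X) + of_bool (top X \<notin> C True X)"
        by (simp add: lab_long C_negate)
      then show ?thesis by (simp only: lab_long[OF False] opposite_label_of_bool)
    qed
  next
    fix X Y assume X: "face n X" and Y: "face n Y" and XY: "X \<subseteq> Y"
    have fin: "finite Y" using Y by (rule face_finite)
    show "lab X \<noteq> opposite_label (lab Y)"
    proof (cases "max_run Y < 2 * k")
      case True
      then have "max_run X < 2 * k" using max_run_mono[OF fin XY] by simp
      have "\<not> (max_run X = max_run Y \<and>
          (run_length False X < run_length True X \<longleftrightarrow> \<not> run_length False Y < run_length True Y))"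
        using run_length_mono[OF fin XY, of True] run_length_mono[OF fin XY, of False]
          run_length_neq[OF X] run_length_neq[OF Y]
        unfolding max_run_def by linarith
      moreover have "max_run X - 1 = max_run Y - 1 \<longleftrightarrow> max_run X = max_run Y"
        using max_run_pos[OF X] max_run_pos[OF Y] by linarith
      ultimately show ?thesis
        unfolding lab_short[OF True] lab_short[OF \<open>max_run X < 2 * k\<close>] opposite_label_of_bool code_eq_iff
        by blast
    next
      case Y_long: False
      show ?thesis
      proof (cases "max_run X < 2 * k")
        case True
        then have "max_run X - 1 \<noteq> 2 * k - 2 + top Y"
          using top_pos[OF Y Y_long] \<open>1 \<le> k\<close> max_run_pos[OF X] by linarith
        then show ?thesis
          unfolding lab_short[OF True] lab_long[OF Y_long] opposite_label_of_bool code_eq_iff by blast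
      next
        case X_long: False
        have "\<not> (top X = top Y \<and> (top X \<in> C True X \<longleftrightarrow> top Y \<notin> C True Y))"
        proof
          assume same: "top X = top Y \<and> (top X \<in> C True X \<longleftrightarrow> top Y \<notin> C True Y)"
          show False
          proof (cases "top X \<in> C True X")
            case True
            then have "top X \<in> C True Y" using C_mono[OF XY] by (rule subsetD[rotated])
            then show False using same True by simp
          next
            case False
            then have "top X \<in> C False X" using top_in[OF X X_long] by simp
            then have "top X \<in> C False Y" using C_mono[OF XY] by (rule subsetD[rotated])
            moreover have "top X \<in> C True Y" using same False by simp
            ultimately show False using C_disjoint[OF Y] by auto
          qed
        qed
        then show ?thesis
          unfolding lab_long[OF X_long] lab_long[OF Y_long] opposite_label_of_bool code_eq_iff by simp
      qed
    qed
  qed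
  have "n > 0" using assms by simp
  then obtain X where X: "face n X" "2 * (n - 1) \<le> lab X" by (rule exists_large_label)
  show False
  proof (cases "max_run X < 2 * k")
    case True
    then have "lab X \<le> 2 * (max_run X - 1) + 1" by (simp add: lab_short)
    then show False using X(2) True max_run_pos[OF X(1)] assms(1,3) by linarith
  next
    case False
    then have "lab X \<le> 2 * (2 * k - 2 + top X) + 1" by (simp add: lab_long)
    moreover have "top X < q" using top_in[OF X(1) False] C_bound by blast
    moreover have "2 * k - 2 + q \<le> n - 1" using assms(1-3) by arith
    moreover have "2 * (n - 1) \<le> lab X" by (rule X(2))
    ultimately have "2 * (2 * k - 2 + q) \<le> 2 * (2 * k - 2 + top X) + 1"
      by (meson le_trans mult_le_mono2)
    then show False using \<open>top X < q\<close> by presburger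
  qed
qed

section \<open>Tournaments in which all small sets are dominated\<close>

text \<open>
  The probability that a random subset of \<open>P\<close> avoids all patterns \<open>g i\<close> on the blocks \<open>B i\<close>, in terms of
  numbers: the blocks are disjoint, so the events are independent, and each has probability at most
  \<open>1 - 1 / 2 ^ s\<close>.
\<close>

lemma card_subsets_avoiding_patterns:
  fixes B g :: "'i \<Rightarrow> 'a set"
  assumes "finite P" "finite I" "\<And>i. i \<in> I \<Longrightarrow> g i \<subseteq> B i \<and> B i \<subseteq> P \<and> card (B i) \<le> s"
    and "disjoint_family_on B I"
  shows "real (card {E\<in>Pow P. \<forall>i\<in>I. E \<inter> B i \<noteq> g i}) \<le> 2 ^ card P * (1 - 1 / 2 ^ s) ^ card I"
  using assms(2,1,3,4)
proof (induction I arbitrary: P rule: finite_induct)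
  case empty
  then show ?case by (simp add: card_Pow flip: Pow_def)
next
  case (insert i I)
  let ?F = "\<lambda>P I. {E\<in>Pow P. \<forall>i\<in>I. E \<inter> B i \<noteq> g i}"
  have i: "g i \<subseteq> B i" "B i \<subseteq> P" "card (B i) \<le> s" using insert.prems(2) by auto
  have fin: "finite (B i)" using i(2) insert.prems(1) finite_subset by blast
  have disj: "B j \<inter> B i = {}" if "j \<in> I" for j
    using insert.prems(3) insert.hyps(2) that by (force simp: disjoint_family_on_def)
  have "bij_betw (\<lambda>E. (E \<inter> B i, E - B i)) (?F P (insert i I)) ((Pow (B i) - {g i}) \<times> ?F (P - B i) I)"
  proof (rule bij_betwI[where g = "\<lambda>(X, Y). X \<union> Y"])
    show "(\<lambda>E. (E \<inter> B i, E - B i)) \<in> ?F P (insert i I) \<rightarrow> (Pow (B i) - {g i}) \<times> ?F (P - B i) I"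
    proof
      fix E assume E: "E \<in> ?F P (insert i I)"
      have "(E - B i) \<inter> B j = E \<inter> B j" if "j \<in> I" for j using disj[OF that] by blast
      then show "(E \<inter> B i, E - B i) \<in> (Pow (B i) - {g i}) \<times> ?F (P - B i) I" using E by auto
    qed
    show "(\<lambda>(X, Y). X \<union> Y) \<in> (Pow (B i) - {g i}) \<times> ?F (P - B i) I \<rightarrow> ?F P (insert i I)"
    proof
      fix p assume p: "p \<in> (Pow (B i) - {g i}) \<times> ?F (P - B i) I"
      obtain X Y where XY: "p = (X, Y)" "X \<subseteq> B i" "X \<noteq> g i" "Y \<subseteq> P - B i" "\<forall>j\<in>I. Y \<inter> B j \<noteq> g j"
        using p by auto
      have "(X \<union> Y) \<inter> B j = Y \<inter> B j" if "j \<in> I" for j using disj[OF that] XY(2) by blast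
      moreover have "(X \<union> Y) \<inter> B i = X" using XY(2,4) by blast
      ultimately have "X \<union> Y \<in> ?F P (insert i I)" using XY i(2) by auto
      then show "(case p of (X, Y) \<Rightarrow> X \<union> Y) \<in> ?F P (insert i I)" using XY(1) by simp
    qed
  qed auto
  then have "card (?F P (insert i I)) = card (Pow (B i) - {g i}) * card (?F (P - B i) I)"
    by (simp add: bij_betw_same_card card_cartesian_product)
  also have "card (Pow (B i) - {g i}) = 2 ^ card (B i) - 1"
    using i(1) fin by (simp add: card_Pow)
  finally have card: "real (card (?F P (insert i I))) =
      (2 ^ card (B i) - 1) * real (card (?F (P - B i) I))"
    by (simp add: of_nat_diff)
  have "real (card (?F (P - B i) I)) \<le> 2 ^ card (P - B i) * (1 - 1 / 2 ^ s) ^ card I"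
  proof (rule insert.IH)
    show "finite (P - B i)" using insert.prems(1) by simp
    show "g j \<subseteq> B j \<and> B j \<subseteq> P - B i \<and> card (B j) \<le> s" if "j \<in> I" for j
      using insert.prems(2)[of j] disj[OF that] that by blast
    show "disjoint_family_on B I" using insert.prems(3) by (auto simp: disjoint_family_on_def)
  qed
  then have "real (card (?F P (insert i I))) \<le>
      (2 ^ card (B i) - 1) * (2 ^ card (P - B i) * (1 - 1 / 2 ^ s) ^ card I)"
    unfolding card by (intro mult_left_mono) simp_all
  also have "\<dots> = (1 - 1 / 2 ^ card (B i)) * (2 ^ card (B i) * 2 ^ card (P - B i)) * (1 - 1 / 2 ^ s) ^ card I"
    by (simp add: field_simps)
  also have "2 ^ card (B i) * 2 ^ card (P - B i) = (2 ^ card P :: real)"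
  proof -
    have "card (B i) + card (P - B i) = card P"
      using fin i(2) insert.prems(1) by (metis card_Diff_subset card_mono le_add_diff_inverse)
    then show ?thesis by (simp flip: power_add)
  qed
  also have "(1 - 1 / 2 ^ card (B i)) * 2 ^ card P * (1 - 1 / 2 ^ s) ^ card I \<le>
      (1 - 1 / 2 ^ s) * 2 ^ card P * (1 - 1 / (2::real) ^ s) ^ card I"
  proof (intro mult_right_mono)
    show "1 - 1 / 2 ^ card (B i) \<le> 1 - 1 / (2::real) ^ s"
      using i(3) by (intro diff_left_mono divide_left_mono power_increasing) auto
  qed simp_all
  also have "\<dots> = 2 ^ card P * (1 - 1 / 2 ^ s) ^ card (insert i I)"
    using insert.hyps by simp
  finally show ?case .
qed

text \<open>
  Every such set is listed by \<open>d\<close> numbers, where \<open>n\<close> serves as filler.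
\<close>

lemma card_small_subsets_le: "card {S\<in>Pow {..<n::nat}. card S \<le> d} \<le> (n + 1) ^ d"
proof -
  have "{S\<in>Pow {..<n}. card S \<le> d} \<subseteq> (\<lambda>xs. set xs \<inter> {..<n}) ` {xs. set xs \<subseteq> {..n} \<and> length xs = d}"
  proof
    fix S assume S: "S \<in> {S\<in>Pow {..<n}. card S \<le> d}"
    then have "finite S" using finite_subset by auto
    then have "set (sorted_list_of_set S @ replicate (d - card S) n) \<inter> {..<n} = S" using S by auto
    moreover have "set (sorted_list_of_set S @ replicate (d - card S) n) \<subseteq> {..n}"
      using S \<open>finite S\<close> by auto
    moreover have "length (sorted_list_of_set S @ replicate (d - card S) n) = d" using S by simp
    ultimately show "S \<in> (\<lambda>xs. set xs \<inter> {..<n}) ` {xs. set xs \<subseteq> {..n} \<and> length xs = d}"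
      by (metis (mono_tags, lifting) image_eqI mem_Collect_eq)
  qed
  moreover have fin: "finite {xs. set xs \<subseteq> {..n} \<and> length xs = d}"
    by (rule finite_lists_length_eq) simp
  ultimately have "card {S\<in>Pow {..<n}. card S \<le> d} \<le>
      card ((\<lambda>xs. set xs \<inter> {..<n}) ` {xs. set xs \<subseteq> {..n} \<and> length xs = d})"
    by (intro card_mono) simp_all
  also have "\<dots> \<le> card {xs. set xs \<subseteq> {..n} \<and> length xs = d}" using fin by (rule card_image_le)
  also have "\<dots> = (n + 1) ^ d" by (simp add: card_lists_length_eq)
  finally show ?thesis .
qed

text \<open>Schuette\<close>

text \<open>
  Erdos's argument for tournaments in which every \<open>s\<close> vertices have a common dominator. The
  tournament on \<open>{..<n}\<close> is given by the random set \<open>E\<close> of those pairs \<open>i < j\<close> that are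
  oriented from \<open>i\<close> to \<open>j\<close>. A given \<open>J\<close> is dominated by \<open>i\<close> if and only if \<open>E\<close> has a certain pattern on the block
  of pairs between \<open>i\<close> and \<open>J\<close>, and these blocks are disjoint for different \<open>i\<close>. The hypothesis makes
  the sum of the failure probabilities over all \<open>J\<close> less than \<open>1\<close>.
\<close>

lemma exists_dominating_relation:
  fixes n s :: nat
  assumes "s \<le> n" "real ((n + 1) ^ s) * (1 - 1 / 2 ^ s) ^ (n - s) < 1"
  obtains R :: "nat \<Rightarrow> nat \<Rightarrow> bool" where "\<And>i j. R i j \<Longrightarrow> \<not> R j i"
    "\<And>J. J \<subseteq> {..<n} \<Longrightarrow> card J \<le> s \<Longrightarrow> \<exists>i<n. \<forall>j\<in>J. R i j"
proof -
  define P where "P = {(i, j). i < j \<and> j < n}"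
  have "P \<subseteq> {..<n} \<times> {..<n}" unfolding P_def by auto
  then have finP: "finite P" by (rule finite_subset) simp
  define R where "R E i j \<longleftrightarrow> i < j \<and> (i, j) \<in> E \<or> j < i \<and> (j, i) \<notin> E" for E :: "nat rel" and i j
  define JJ where "JJ = {J\<in>Pow {..<n}. card J \<le> s}"
  define bad where "bad J = {E\<in>Pow P. \<forall>i\<in>{..<n} - J. \<not> (\<forall>j\<in>J. R E i j)}" for J
  have card_bad: "real (card (bad J)) \<le> 2 ^ card P * (1 - 1 / 2 ^ s) ^ (n - s)" if J: "J \<in> JJ" for J
  proof -
    define B where "B i = (\<lambda>j. (min i j, max i j)) ` J" for i
    define g where "g i = (\<lambda>j. (i, j)) ` {j\<in>J. i < j}" for i
    have finJ: "finite J" and Jn: "J \<subseteq> {..<n}" and Js: "card J \<le> s"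
      using J finite_subset[of J "{..<n}"] unfolding JJ_def by auto
    have g_subset: "g i \<subseteq> B i" for i
    proof
      fix p assume "p \<in> g i"
      then obtain j where "j \<in> J" "p = (min i j, max i j)" unfolding g_def by fastforce
      then show "p \<in> B i" unfolding B_def by blast
    qed
    have "E \<inter> B i = g i \<longleftrightarrow> (\<forall>j\<in>J. R E i j)" if "i \<notin> J" for E i
    proof -
      have "E \<inter> B i = g i \<longleftrightarrow> (\<forall>p\<in>B i. p \<in> E \<longleftrightarrow> p \<in> g i)"
        using g_subset[of i] by blast
      also have "\<dots> \<longleftrightarrow> (\<forall>j\<in>J. (min i j, max i j) \<in> E \<longleftrightarrow> (min i j, max i j) \<in> g i)"
        unfolding B_def by blast
      also have "\<dots> \<longleftrightarrow> (\<forall>j\<in>J. R E i j)"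
      proof (rule ball_cong[OF refl])
        fix j assume "j \<in> J"
        then show "((min i j, max i j) \<in> E \<longleftrightarrow> (min i j, max i j) \<in> g i) \<longleftrightarrow> R E i j"
          using \<open>i \<notin> J\<close> unfolding R_def g_def by (cases i j rule: linorder_cases) auto
      qed
      finally show ?thesis .
    qed
    then have "bad J = {E\<in>Pow P. \<forall>i\<in>{..<n} - J. E \<inter> B i \<noteq> g i}" unfolding bad_def by auto
    also have "real (card \<dots>) \<le> 2 ^ card P * (1 - 1 / 2 ^ s) ^ card ({..<n} - J)"
    proof (rule card_subsets_avoiding_patterns[OF finP])
      show "g i \<subseteq> B i \<and> B i \<subseteq> P \<and> card (B i) \<le> s" if i: "i \<in> {..<n} - J" for i
      proof (intro conjI)
        show "g i \<subseteq> B i" by (rule g_subset)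
        show "B i \<subseteq> P"
        proof
          fix p assume "p \<in> B i"
          then obtain j where j: "j \<in> J" "p = (min i j, max i j)" unfolding B_def by blast
          then have "j \<noteq> i" "j < n" "i < n" using i Jn by auto
          then show "p \<in> P" unfolding P_def j(2) by auto
        qed
        show "card (B i) \<le> s" unfolding B_def using Js card_image_le[OF finJ] le_trans by blast
      qed
      show "disjoint_family_on B ({..<n} - J)"
        unfolding disjoint_family_on_def
      proof (intro ballI impI)
        fix i i' assume ii': "i \<in> {..<n} - J" "i' \<in> {..<n} - J" "i \<noteq> i'"
        show "B i \<inter> B i' = {}"
        proof (rule ccontr)
          assume "B i \<inter> B i' \<noteq> {}"
          then obtain j j' where "j \<in> J" "j' \<in> J" "(min i j, max i j) = (min i' j', max i' j')"
            unfolding B_def by blast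
          moreover from this have "{i, j} = {i', j'}" by (auto simp: min_def max_def split: if_splits)
          ultimately show False using ii' by (auto simp: doubleton_eq_iff)
        qed
      qed
    qed simp
    also have "\<dots> \<le> 2 ^ card P * (1 - 1 / 2 ^ s) ^ (n - s)"
    proof -
      have "n - s \<le> card ({..<n} - J)" using finJ Jn Js by (simp add: card_Diff_subset)
      then show ?thesis by (intro mult_left_mono power_decreasing) auto
    qed
    finally show ?thesis .
  qed
  have "finite JJ" unfolding JJ_def by simp
  have "(\<Sum>J\<in>JJ. real (card (bad J))) \<le> real (card JJ) * (2 ^ card P * (1 - 1 / 2 ^ s) ^ (n - s))"
    by (rule sum_bounded_above) (rule card_bad)
  also have "\<dots> \<le> real ((n + 1) ^ s) * (2 ^ card P * (1 - 1 / 2 ^ s) ^ (n - s))"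
    unfolding JJ_def using card_small_subsets_le[of n s] by (intro mult_right_mono) (simp_all only: of_nat_le_iff, simp)
  also have "\<dots> < 2 ^ card P"
    using mult_strict_left_mono[OF assms(2), of "2 ^ card P"] by (simp add: mult_ac)
  finally have sum_less: "(\<Sum>J\<in>JJ. real (card (bad J))) < real (card (Pow P))"
    using finP by (simp add: card_Pow)
  have "real (card (\<Union>J\<in>JJ. bad J)) \<le> (\<Sum>J\<in>JJ. real (card (bad J)))"
    using card_UN_le[OF \<open>finite JJ\<close>, of bad] by (simp flip: of_nat_sum)
  with sum_less have "card (\<Union>J\<in>JJ. bad J) < card (Pow P)" by simp
  moreover have "finite (\<Union>J\<in>JJ. bad J)" using \<open>finite JJ\<close> finP unfolding bad_def by simp
  ultimately have "\<not> Pow P \<subseteq> (\<Union>J\<in>JJ. bad J)"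
    using card_mono[of "\<Union>J\<in>JJ. bad J" "Pow P"] by linarith
  then obtain E where E: "E \<subseteq> P" "\<And>J. J \<in> JJ \<Longrightarrow> E \<notin> bad J" by auto
  show thesis
  proof (rule that)
    show "R E i j \<Longrightarrow> \<not> R E j i" for i j unfolding R_def by auto
    show "\<exists>i<n. \<forall>j\<in>J. R E i j" if "J \<subseteq> {..<n}" "card J \<le> s" for J
      using E(1) E(2)[of J] that unfolding bad_def JJ_def by auto
  qed
qed

text \<open>
  Let \<open>L = ln (n + 1)\<close> and \<open>s \<le> L / 2\<close>. Then \<open>2 ^ s\<close> is at most \<open>exp (L / 2)\<close>, the square root of \<open>n + 1\<close>. So each of
  the at most \<open>exp (s * L) \<le> exp (L\<^sup>2 / 2)\<close> sets fails with a probability of at most roughly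
  \<open>exp (- sqrt n)\<close>, and \<open>L\<^sup>2 / 2\<close> is of smaller order than \<open>sqrt n\<close>.
\<close>

lemma eventually_dominating_relation:
  "\<forall>\<^sub>F n::nat in sequentially. \<exists>R :: nat \<Rightarrow> nat \<Rightarrow> bool. (\<forall>i j. R i j \<longrightarrow> \<not> R j i) \<and>
     (\<forall>J\<subseteq>{..<n}. real (card J) \<le> ln (real (n + 1)) / 2 \<longrightarrow> (\<exists>i<n. \<forall>j\<in>J. R i j))"
proof -
  have "\<forall>\<^sub>F n::nat in sequentially. (ln (real (n + 1)))\<^sup>2 / 2 < (real n - ln (real (n + 1)) / 2) / sqrt (real (n + 1))"
    by real_asymp
  moreover have "\<forall>\<^sub>F n::nat in sequentially. ln (real (n + 1)) / 2 \<le> real n" by real_asymp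
  ultimately show ?thesis
  proof eventually_elim
    case (elim n)
    define L where "L = ln (real (n + 1))"
    define s where "s = nat \<lfloor>L / 2\<rfloor>"
    have L0: "L \<ge> 0" unfolding L_def by simp
    have s: "real s \<le> L / 2" unfolding s_def using L0 by linarith
    have "s \<le> n" using s elim(2) unfolding L_def by linarith
    have "(2::real) ^ s = exp (real s * ln 2)" by (simp add: exp_of_nat_mult)
    also have "\<dots> \<le> exp (L / 2)"
    proof -
      have "real s * ln 2 \<le> real s * 1" using ln_2_less_1 by (intro mult_left_mono) auto
      then show ?thesis using s by simp
    qed
    also have "\<dots> = sqrt (real (n + 1))"
      unfolding L_def by (intro real_sqrt_unique[symmetric]) (simp_all flip: exp_double)
    finally have pow: "(2::real) ^ s \<le> sqrt (real (n + 1))" .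
    have "(1 - 1 / (2::real) ^ s) ^ (n - s) \<le> exp (- 1 / 2 ^ s) ^ (n - s)"
    proof (rule power_mono)
      show "1 - 1 / 2 ^ s \<le> exp (- 1 / (2::real) ^ s)" using exp_ge_add_one_self[of "- 1 / (2::real) ^ s"] by simp
    qed simp
    also have "\<dots> = exp (- (real (n - s) / 2 ^ s))" by (simp flip: exp_of_nat_mult)
    also have "\<dots> \<le> exp (- ((real n - L / 2) / sqrt (real (n + 1))))"
    proof -
      have "(real n - L / 2) / sqrt (real (n + 1)) \<le> real (n - s) / sqrt (real (n + 1))"
        using s \<open>s \<le> n\<close> by (intro divide_right_mono) (auto simp: of_nat_diff)
      also have "\<dots> \<le> real (n - s) / 2 ^ s" using pow by (intro divide_left_mono) auto
      finally show ?thesis by simp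
    qed
    also have "\<dots> < exp (- (L\<^sup>2 / 2))" using elim(1) unfolding L_def by simp
    finally have A: "(1 - 1 / (2::real) ^ s) ^ (n - s) < exp (- (L\<^sup>2 / 2))" .
    have "real ((n + 1) ^ s) = exp (real s * L)" unfolding L_def by (simp add: exp_of_nat_mult)
    also have "\<dots> \<le> exp (L\<^sup>2 / 2)"
      using mult_right_mono[OF s L0] by (simp add: power2_eq_square)
    finally have "real ((n + 1) ^ s) * (1 - 1 / (2::real) ^ s) ^ (n - s) < exp (L\<^sup>2 / 2) * exp (- (L\<^sup>2 / 2))"
      using A by (intro mult_le_less_imp_less) auto
    then have less: "real ((n + 1) ^ s) * (1 - 1 / (2::real) ^ s) ^ (n - s) < 1" by (simp flip: exp_add)
    obtain R :: "nat \<Rightarrow> nat \<Rightarrow> bool" where "\<And>i j. R i j \<Longrightarrow> \<not> R j i"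
      "\<And>J. J \<subseteq> {..<n} \<Longrightarrow> card J \<le> s \<Longrightarrow> \<exists>i<n. \<forall>j\<in>J. R i j"
      using exists_dominating_relation[OF \<open>s \<le> n\<close> less] by metis
    moreover have "card J \<le> s" if "real (card J) \<le> ln (real (n + 1)) / 2" for J :: "nat set"
      using that unfolding s_def L_def by linarith
    ultimately show ?case by blast
  qed
qed

section \<open>The tournaments on stable sets\<close>

definition gaps :: "nat \<Rightarrow> nat set \<Rightarrow> nat set" where
  "gaps n A = {..<n} - (A \<union> Suc ` A)"

text \<open>
  The gaps, the set \<open>A\<close> and its shift are disjoint subsets of \<open>{0, \<dots>, n}\<close>.
\<close>

lemma card_gaps:
  assumes "A \<in> stable_sets n k" shows "card (gaps n A) + 2 * k \<le> n + 1"
proof -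
  have A: "A \<subseteq> {..<n}" "card A = k" "A \<inter> Suc ` A = {}" using assms by (auto simp: stable_sets_def)
  have fin: "finite A" using A(1) finite_subset by blast
  have "card (A \<union> Suc ` A) = 2 * k"
    using A fin by (simp add: card_Un_disjoint card_image)
  moreover have "card (gaps n A \<union> (A \<union> Suc ` A)) = card (gaps n A) + card (A \<union> Suc ` A)"
    using fin by (intro card_Un_disjoint) (auto simp: gaps_def)
  moreover have "card (gaps n A \<union> (A \<union> Suc ` A)) \<le> card {..<n + 1}"
    using A(1) by (intro card_mono) (auto simp: gaps_def)
  ultimately show ?thesis by simp
qed

text \<open>
  Read from left to right, a position belongs to the set if and only if it is not a gap and its predecessor
  does not belong to the set.
\<close>

lemma inj_on_gaps: "inj_on (gaps n) (stable_sets n k)"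
proof (rule inj_onI)
  fix A B assume AB: "A \<in> stable_sets n k" "B \<in> stable_sets n k" "gaps n A = gaps n B"
  have mem: "i \<in> A \<longleftrightarrow> i < n \<and> i \<notin> gaps n A \<and> i \<notin> Suc ` A" if "A \<in> stable_sets n k" for A i
    using that by (auto simp: stable_sets_def gaps_def)
  have "i \<in> A \<longleftrightarrow> i \<in> B" for i
  proof (induction i)
    case 0
    then show ?case using mem[OF AB(1), of 0] mem[OF AB(2), of 0] AB(3) by auto
  next
    case (Suc i)
    then show ?case using mem[OF AB(1), of "Suc i"] mem[OF AB(2), of "Suc i"] AB(3) by (simp add: inj_image_mem_iff)
  qed
  then show "A = B" by blast
qed

lemma stable_sets_finite: "finite (stable_sets n k)"
  by (rule finite_subset[of _ "Pow {..<n}"]) (auto simp: stable_sets_def)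

text \<open>
  The vertices are natural numbers in binary code for finite sets, and the usual order on them serves
  as the linear order of the tournament.
\<close>

definition disjoint_codes :: "nat \<Rightarrow> nat \<Rightarrow> bool" where
  "disjoint_codes u v \<longleftrightarrow> set_decode u \<inter> set_decode v = {}"

definition stable_codes :: "nat \<Rightarrow> nat \<Rightarrow> nat set" where
  "stable_codes n k = set_encode ` stable_sets n k"

lemma symp_disjoint_codes: "symp disjoint_codes"
  by (auto simp: symp_def disjoint_codes_def)

lemma set_decode_encode_stable: "A \<in> stable_sets n k \<Longrightarrow> set_decode (set_encode A) = A"
  by (rule set_encode_inverse) (auto simp: stable_sets_def intro: finite_subset)

lemma set_decode_stable_codes: "v \<in> stable_codes n k \<Longrightarrow> set_decode v \<in> stable_sets n k"
  by (auto simp: stable_codes_def set_decode_encode_stable)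

lemma finite_stable_codes: "finite (stable_codes n k)"
  by (simp add: stable_codes_def stable_sets_finite)

lemma card_stable_codes_le:
  assumes "n + 1 \<le> d + 2 * k" shows "card (stable_codes n k) \<le> (n + 1) ^ d"
proof -
  have "card (stable_codes n k) \<le> card (stable_sets n k)"
    unfolding stable_codes_def by (rule card_image_le) (rule stable_sets_finite)
  also have "\<dots> = card (gaps n ` stable_sets n k)" by (rule card_image[symmetric]) (rule inj_on_gaps)
  also have "\<dots> \<le> card {S\<in>Pow {..<n}. card S \<le> d}"
  proof (intro card_mono subsetI)
    fix S assume "S \<in> gaps n ` stable_sets n k"
    then obtain A where A: "A \<in> stable_sets n k" "S = gaps n A" by blast
    then have "card S \<le> d" using card_gaps[OF A(1)] assms by simp
    then show "S \<in> {S\<in>Pow {..<n}. card S \<le> d}" using A(2) by (auto simp: gaps_def)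
  qed simp
  also have "\<dots> \<le> (n + 1) ^ d" by (rule card_small_subsets_le)
  finally show ?thesis .
qed

text \<open>
  A set without a gap at \<open>i\<close> contains \<open>i\<close> or its predecessor, and sets with a common element are not
  adjacent.
\<close>

lemma stable_codes_without_gap_colourable:
  assumes "i < n"
  shows "transitively_colourable {v \<in> stable_codes n k. i \<notin> gaps n (set_decode v)} (backedge_rel disjoint_codes) 2"
proof (rule transitively_colourable_backedge[OF symp_disjoint_codes])
  let ?f = "\<lambda>v. if i \<in> set_decode v then 0 else 1 :: nat"
  show "?f v < 2" for v by simp
  fix u v
  assume "u \<in> {v \<in> stable_codes n k. i \<notin> gaps n (set_decode v)}"
    and "v \<in> {v \<in> stable_codes n k. i \<notin> gaps n (set_decode v)}" and adj: "disjoint_codes u v"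
  then have u: "i \<in> set_decode u \<or> i \<in> Suc ` set_decode u" and v: "i \<in> set_decode v \<or> i \<in> Suc ` set_decode v"
    using assms by (auto simp: gaps_def)
  show "?f u \<noteq> ?f v"
  proof (cases "i \<in> set_decode u \<or> i \<in> set_decode v")
    case True
    then show ?thesis using adj by (auto simp: disjoint_codes_def)
  next
    case False
    then obtain j where "j \<in> set_decode u" "j \<in> set_decode v" using u v by auto
    then show ?thesis using adj by (auto simp: disjoint_codes_def)
  qed
qed

text \<open>
  Three pairwise disjoint vertices would cover \<open>3 * k > n\<close> positions, so the Kneser graph has no
  triangle and \<open>c\<close> transitive classes give a proper colouring with \<open>2 * c\<close> colours, one less than what
  is necessary.
\<close>

lemma stable_codes_not_colourable:
  assumes "1 \<le> c" "2 * c + 2 * k = n + 1" "2 * c < k"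
  shows "\<not> transitively_colourable (stable_codes n k) (backedge_rel disjoint_codes) c"
proof
  assume col: "transitively_colourable (stable_codes n k) (backedge_rel disjoint_codes) c"
  have card: "finite (set_decode v)" "set_decode v \<subseteq> {..<n}" "card (set_decode v) = k"
    if "v \<in> stable_codes n k" for v
    using set_decode_stable_codes[OF that] finite_subset by (auto simp: stable_sets_def)
  have triangle_free: "\<not> disjoint_codes u w"
    if uvw: "u \<in> stable_codes n k" "v \<in> stable_codes n k" "w \<in> stable_codes n k"
      and "disjoint_codes u v" "disjoint_codes v w" for u v w
  proof
    assume "disjoint_codes u w"
    then have "card (set_decode u \<union> set_decode v \<union> set_decode w) = 3 * k"
      using that card by (subst card_Un_disjoint; (subst card_Un_disjoint)?) (auto simp: disjoint_codes_def)
    moreover have "card (set_decode u \<union> set_decode v \<union> set_decode w) \<le> card {..<n}"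
      using card(2) uvw by (intro card_mono) auto
    ultimately show False using assms(2,3) by simp
  qed
  have irrefl: "\<not> disjoint_codes v v" if "v \<in> stable_codes n k" for v
    using card(3)[OF that] assms(3) by (auto simp: disjoint_codes_def)
  have "\<exists>g :: nat \<Rightarrow> nat. (\<forall>v\<in>stable_codes n k. g v < 2 * c) \<and>
      (\<forall>u\<in>stable_codes n k. \<forall>v\<in>stable_codes n k. disjoint_codes u v \<longrightarrow> g u \<noteq> g v)"
  proof (rule proper_colouring_of_transitive_colouring[OF symp_disjoint_codes _ _ col])
    show "\<not> disjoint_codes u w"
      if "u \<in> stable_codes n k" "v \<in> stable_codes n k" "w \<in> stable_codes n k"
        "disjoint_codes u v" "disjoint_codes v w" for u v w
      using that by (rule triangle_free)
  qed (rule irrefl)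
  then obtain g :: "nat \<Rightarrow> nat" where g: "\<And>v. v \<in> stable_codes n k \<Longrightarrow> g v < 2 * c"
    "\<And>u v. u \<in> stable_codes n k \<Longrightarrow> v \<in> stable_codes n k \<Longrightarrow> disjoint_codes u v \<Longrightarrow> g u \<noteq> g v"
    by blast
  have "\<exists>A\<in>stable_sets n k. \<exists>B\<in>stable_sets n k. A \<inter> B = {} \<and> g (set_encode A) = g (set_encode B)"
    using g(1) assms by (intro stable_kneser_not_colourable[where q = "2 * c"]) (auto simp: stable_codes_def)
  then obtain A B where AB: "A \<in> stable_sets n k" "B \<in> stable_sets n k" "A \<inter> B = {}"
      "g (set_encode A) = g (set_encode B)"
    by blast
  then have "disjoint_codes (set_encode A) (set_encode B)"
    by (simp add: disjoint_codes_def set_decode_encode_stable)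
  then show False using g(2) AB by (auto simp: stable_codes_def)
qed

text \<open>
  A transitive tournament, with the arc between \<open>0\<close> and \<open>2\<close> reversed if \<open>\<chi> = 2\<close>, which creates the cyclic
  triangle \<open>0, 1, 2\<close>.
\<close>

lemma tournament_pair_with_few_colours:
  fixes \<chi> :: nat
  assumes "\<chi> = 1 \<or> \<chi> = 2"
  shows "\<exists>N>M. \<exists>(V :: nat set) (T1 :: nat pair_pre_digraph) (T2 :: nat pair_pre_digraph).
    finite V \<and> card V = N \<and>
    tournament (with_proj T1) \<and> pverts T1 = V \<and>
    tournament (with_proj T2) \<and> pverts T2 = V \<and>
    chromatic_number (with_proj T1) = \<chi> \<and>
    (\<forall>U \<subseteq> V. chromatic_number (with_proj T1 \<restriction> out_neighbourhood (with_proj T2) U) \<le> 2)"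
proof -
  define V where "V = {..<M + 3}"
  define adj where "adj u v \<longleftrightarrow> \<chi> = 2 \<and> {u, v} = {0, 2 :: nat}" for u v :: nat
  define T where "T = backedge_digraph V adj"
  have sym: "symp adj" by (auto simp: symp_def adj_def insert_commute)
  have fin: "finite V" by (simp add: V_def)
  have col: "transitively_colourable V (backedge_rel adj) \<chi>"
    by (rule transitively_colourable_backedge[OF sym, where f = "\<lambda>v. if \<chi> = 2 \<and> v = 0 then 1 else 0"])
      (use assms in \<open>auto simp: adj_def doubleton_eq_iff\<close>)
  have "\<not> transitively_colourable V (backedge_rel adj) (\<chi> - 1)"
  proof
    assume "transitively_colourable V (backedge_rel adj) (\<chi> - 1)"
    then obtain f where f: "\<forall>v\<in>V. f v < \<chi> - 1"
        and tr: "\<And>c. trans (backedge_rel adj \<inter> {v\<in>V. f v = c} \<times> {v\<in>V. f v = c})"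
      unfolding transitively_colourable_def by blast
    have V: "0 \<in> V" "1 \<in> V" "2 \<in> V" by (auto simp: V_def)
    then have "\<chi> = 2" using f assms by auto
    then have f0: "f 0 = 0" "f 1 = 0" "f 2 = 0" using f V by auto
    let ?E = "backedge_rel adj \<inter> {v\<in>V. f v = 0} \<times> {v\<in>V. f v = 0}"
    have "(0, 1) \<in> ?E" "(1, 2) \<in> ?E" using V f0 by (auto simp: backedge_rel_def backedge_arc_def adj_def doubleton_eq_iff)
    then have "(0, 2) \<in> ?E" by (rule transD[OF tr])
    then show False using \<open>\<chi> = 2\<close> by (simp add: backedge_rel_def backedge_arc_def adj_def)
  qed
  then have "chromatic_number (with_proj T) = \<chi>"
    using col chromatic_number_backedge_le_iff[OF fin, of adj \<chi>]
      chromatic_number_backedge_le_iff[OF fin, of adj "\<chi> - 1"] unfolding T_def by linarith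
  moreover have "chromatic_number (with_proj T \<restriction> out_neighbourhood (with_proj T) U) \<le> 2" for U
  proof -
    have "out_neighbourhood (with_proj T) U \<subseteq> V"
      by (auto simp: out_neighbourhood_def T_def parcs_backedge_digraph)
    then show ?thesis
      unfolding T_def using transitively_colourable_mono[OF col, of _ 2] assms
      by (subst chromatic_number_induced_backedge_le_iff[OF fin]) auto
  qed
  moreover have "tournament (with_proj T)" unfolding T_def by (rule tournament_backedge_digraph[OF fin sym])
  ultimately show ?thesis
    by (intro exI[of _ "M + 3"] conjI exI[of _ V] exI[of _ T]) (auto simp: V_def T_def)
qed

text \<open>
  The bound on \<open>U\<close> leaves room for two factors \<open>d < 2 * \<chi>\<close>: one because a vertex has up to \<open>d\<close> gaps, the
  other because \<open>ln N\<close> is at most \<open>d * ln (n + 1)\<close>. With the constant \<open>8\<close>, half of \<open>ln (n + 1)\<close> remains, which is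
  the size up to which sets of positions are dominated.
\<close>

lemma tournament_pair_with_many_colours:
  fixes \<chi> :: nat
  assumes "\<chi> \<ge> 3"
  shows "\<exists>N>M. \<exists>(V :: nat set) (T1 :: nat pair_pre_digraph) (T2 :: nat pair_pre_digraph).
    finite V \<and> card V = N \<and>
    tournament (with_proj T1) \<and> pverts T1 = V \<and>
    tournament (with_proj T2) \<and> pverts T2 = V \<and>
    chromatic_number (with_proj T1) = \<chi> \<and>
    (\<forall>U \<subseteq> V. real (card U) \<le> ln (real N) / (8 * (real \<chi>)\<^sup>2) \<longrightarrow>
      chromatic_number (with_proj T1 \<restriction> out_neighbourhood (with_proj T2) U) \<le> 2)"
proof -
  define d where "d = 2 * (\<chi> - 1)"
  obtain n0 where n0: "\<And>n. n \<ge> n0 \<Longrightarrow> \<exists>R :: nat \<Rightarrow> nat \<Rightarrow> bool. (\<forall>i j. R i j \<longrightarrow> \<not> R j i) \<and>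
     (\<forall>J\<subseteq>{..<n}. real (card J) \<le> ln (real (n + 1)) / 2 \<longrightarrow> (\<exists>i<n. \<forall>j\<in>J. R i j))"
    using eventually_dominating_relation unfolding eventually_sequentially by blast
  \<comment> \<open>The summands give a dominating relation, many vertices, and freedom from triangles.\<close>
  define k where "k = n0 + d * M + d + 1"
  define n where "n = 2 * k + d - 1"
  have d: "d > 0" using assms by (simp add: d_def)
  have "n \<ge> n0" "d * M < n" "n + 1 = d + 2 * k" using d unfolding n_def k_def by auto
  obtain R :: "nat \<Rightarrow> nat \<Rightarrow> bool" where asym: "\<And>i j. R i j \<Longrightarrow> \<not> R j i"
    and dominated: "\<And>J. J \<subseteq> {..<n} \<Longrightarrow> real (card J) \<le> ln (real (n + 1)) / 2 \<Longrightarrow> \<exists>i<n. \<forall>j\<in>J. R i j"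
    using n0[OF \<open>n \<ge> n0\<close>] by metis
  let ?E = "backedge_rel disjoint_codes"
  define gap where "gap v = gaps n (set_decode v)" for v
  have "\<not> transitively_colourable (stable_codes n k) ?E (\<chi> - 1)"
    using assms \<open>n + 1 = d + 2 * k\<close>
    by (intro stable_codes_not_colourable) (auto simp: d_def k_def)
  then obtain V where V: "V \<subseteq> stable_codes n k" "\<not> transitively_colourable V ?E (\<chi> - 1)"
      "transitively_colourable V ?E \<chi>"
    using exists_critical_subset[OF finite_stable_codes, of n k ?E "\<chi> - 1"] assms by auto
  have fin: "finite V" using V(1) finite_stable_codes by (rule finite_subset)
  define N where "N = card V"
  have card_gap: "card (gap v) \<le> d" if "v \<in> V" for v
    using card_gaps[OF set_decode_stable_codes, of v n k] V(1) that \<open>n + 1 = d + 2 * k\<close>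
    unfolding gap_def by auto
  have card_UN_gap: "card (\<Union>v\<in>U. gap v) \<le> d * card U" if "U \<subseteq> V" for U
  proof -
    have "finite U" using that fin by (rule finite_subset)
    then have "card (\<Union>v\<in>U. gap v) \<le> (\<Sum>v\<in>U. card (gap v))" by (rule card_UN_le)
    also have "\<dots> \<le> (\<Sum>v\<in>U. d)" using card_gap that by (intro sum_mono) auto
    finally show ?thesis by (simp add: mult.commute)
  qed
  have avoid: "transitively_colourable {v\<in>V. i \<notin> gap v} ?E 2" if "i < n" for i
    by (rule transitively_colourable_mono[OF stable_codes_without_gap_colourable[OF that, of k]])
      (use V(1) in \<open>auto simp: gap_def\<close>)
  \<comment> \<open>If no vertex of \<open>V\<close> had a gap at \<open>i\<close>, two colours would suffice for \<open>V\<close>; so all \<open>n\<close> positions are gaps.\<close>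
  have "M < N"
  proof -
    have "{..<n} \<subseteq> (\<Union>v\<in>V. gap v)"
    proof
      fix i assume "i \<in> {..<n}"
      show "i \<in> (\<Union>v\<in>V. gap v)"
      proof (rule ccontr)
        assume "i \<notin> (\<Union>v\<in>V. gap v)"
        then have "V = {v\<in>V. i \<notin> gap v}" by blast
        then have "transitively_colourable V ?E 2" using avoid \<open>i \<in> {..<n}\<close> by (metis lessThan_iff)
        moreover have "2 \<le> \<chi> - 1" using assms by simp
        ultimately have "transitively_colourable V ?E (\<chi> - 1)"
          by (rule transitively_colourable_mono[OF _ order_refl])
        then show False using V(2) by simp
      qed
    qed
    moreover have "finite (\<Union>v\<in>V. gap v)" using fin by (simp add: gap_def gaps_def)
    ultimately have "card {..<n} \<le> card (\<Union>v\<in>V. gap v)" by (rule card_mono[rotated])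
    also have "\<dots> \<le> d * N" unfolding N_def by (rule card_UN_gap) simp
    finally have "n \<le> d * N" by simp
    then have "d * M < d * N" using \<open>d * M < n\<close> by (rule less_le_trans[rotated])
    then show ?thesis by simp
  qed
  define T1 where "T1 = backedge_digraph V disjoint_codes"
  have T1: "tournament (with_proj T1)"
    unfolding T1_def using fin symp_disjoint_codes by (rule tournament_backedge_digraph)
  have chi: "chromatic_number (with_proj T1) = \<chi>"
    using V(2,3) chromatic_number_backedge_le_iff[OF fin, of disjoint_codes \<chi>]
      chromatic_number_backedge_le_iff[OF fin, of disjoint_codes "\<chi> - 1"] unfolding T1_def by linarith
  define dom where "dom w u \<longleftrightarrow> (\<exists>i\<in>gap w. \<forall>j\<in>gap u. R i j)" for w u
  have dom_asym: "\<not> dom u w" if dom: "dom w u" for u w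
  proof
    assume "dom u w"
    then obtain j where "j \<in> gap u" "\<forall>i\<in>gap w. R j i" unfolding dom_def by blast
    moreover obtain i where "i \<in> gap w" "\<forall>j\<in>gap u. R i j" using dom unfolding dom_def by blast
    ultimately show False using asym by blast
  qed
  \<comment> \<open>Pairs that are not decided by the gaps may be oriented arbitrarily, here by the order of the codes.\<close>
  define arc where "arc u v \<longleftrightarrow> dom u v \<or> \<not> dom v u \<and> u < v" for u v :: nat
  define T2 where "T2 = \<lparr>pverts = V, parcs = {(u, v). u \<in> V \<and> v \<in> V \<and> arc u v}\<rparr>"
  have T2: "tournament (with_proj T2)"
    unfolding T2_def
  proof (rule tournament_with_proj[OF fin])
    show "\<not> arc u u" for u using dom_asym[of u u] by (auto simp: arc_def)
    show "arc u v \<longleftrightarrow> \<not> arc v u" if "u \<noteq> v" for u v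
      using dom_asym[of u v] dom_asym[of v u] that unfolding arc_def by auto
  qed
  have lnN: "ln (real N) \<le> real d * ln (real (n + 1))"
  proof -
    have "N \<le> (n + 1) ^ d"
      using card_mono[OF finite_stable_codes V(1)] card_stable_codes_le[of n d k] \<open>n + 1 = d + 2 * k\<close>
      unfolding N_def by simp
    then have "real N \<le> real (n + 1) ^ d" by (metis of_nat_le_iff of_nat_power)
    then have "ln (real N) \<le> ln (real (n + 1) ^ d)" using \<open>M < N\<close> by (intro ln_mono) auto
    then show ?thesis by (simp add: ln_realpow)
  qed
  have "chromatic_number (with_proj T1 \<restriction> out_neighbourhood (with_proj T2) U) \<le> 2"
    if U: "U \<subseteq> V" "real (card U) \<le> ln (real N) / (8 * (real \<chi>)\<^sup>2)" for U
  proof -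
    let ?J = "\<Union>v\<in>U. gap v" and ?L = "ln (real (n + 1))"
    have "real (card ?J) \<le> real d * real (card U)"
      using card_UN_gap[OF U(1)] by (metis of_nat_le_iff of_nat_mult)
    also have "\<dots> \<le> real d * (ln (real N) / (8 * (real \<chi>)\<^sup>2))"
      using U(2) by (intro mult_left_mono) auto
    also have "\<dots> \<le> real d * (real d * ?L / (8 * (real \<chi>)\<^sup>2))"
      using lnN by (intro mult_left_mono divide_right_mono) auto
    also have "\<dots> = (real d)\<^sup>2 * (?L / (8 * (real \<chi>)\<^sup>2))" by (simp add: power2_eq_square)
    also have "\<dots> \<le> (2 * real \<chi>)\<^sup>2 * (?L / (8 * (real \<chi>)\<^sup>2))"
      by (intro mult_right_mono power_mono) (auto simp: d_def)
    also have "\<dots> = ?L / 2" using assms by (simp add: field_simps power2_eq_square)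
    finally have "real (card ?J) \<le> ?L / 2" .
    moreover have "?J \<subseteq> {..<n}" by (auto simp: gap_def gaps_def)
    ultimately obtain i where i: "i < n" "\<forall>j\<in>?J. R i j" using dominated by blast
    have sub: "out_neighbourhood (with_proj T2) U \<subseteq> {v\<in>V. i \<notin> gap v}"
    proof
      fix w assume "w \<in> out_neighbourhood (with_proj T2) U"
      then obtain u where u: "u \<in> U" "w \<in> V" "arc u w" by (auto simp: out_neighbourhood_def T2_def)
      have "i \<notin> gap w"
      proof
        assume "i \<in> gap w"
        then have "dom w u" using i(2) u(1) unfolding dom_def by blast
        then show False using u(3) dom_asym unfolding arc_def by blast
      qed
      then show "w \<in> {v\<in>V. i \<notin> gap v}" using u(2) by simp
    qed
    then have "transitively_colourable (out_neighbourhood (with_proj T2) U) ?E 2"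
      using transitively_colourable_mono[OF avoid[OF i(1)]] by blast
    then show ?thesis
      unfolding T1_def using sub by (subst chromatic_number_induced_backedge_le_iff[OF fin]) auto
  qed
  then show ?thesis
    using \<open>M < N\<close> fin T1 T2 chi N_def
    by (intro exI[of _ N] conjI exI[of _ V] exI[of _ T1] exI[of _ T2]) (auto simp: T1_def T2_def)
qed

theorem corollary3:
  fixes \<chi> :: nat
  assumes "\<chi> \<ge> 1"
  shows "\<forall>M. \<exists>N>M. \<exists>(V :: nat set) (T1 :: nat pair_pre_digraph) (T2 :: nat pair_pre_digraph).
    finite V \<and> card V = N \<and>
    tournament (with_proj T1) \<and> pverts T1 = V \<and>
    tournament (with_proj T2) \<and> pverts T2 = V \<and>
    chromatic_number (with_proj T1) = \<chi> \<and>
    (\<forall>U \<subseteq> V. real (card U) \<le> ln (real N) / (8 * (real \<chi>)\<^sup>2) \<longrightarrow>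
      chromatic_number (with_proj T1 \<restriction> out_neighbourhood (with_proj T2) U) \<le> 2)"
proof
  fix M
  show "\<exists>N>M. \<exists>(V :: nat set) (T1 :: nat pair_pre_digraph) (T2 :: nat pair_pre_digraph).
    finite V \<and> card V = N \<and>
    tournament (with_proj T1) \<and> pverts T1 = V \<and>
    tournament (with_proj T2) \<and> pverts T2 = V \<and>
    chromatic_number (with_proj T1) = \<chi> \<and>
    (\<forall>U \<subseteq> V. real (card U) \<le> ln (real N) / (8 * (real \<chi>)\<^sup>2) \<longrightarrow>
      chromatic_number (with_proj T1 \<restriction> out_neighbourhood (with_proj T2) U) \<le> 2)"
  proof (cases "\<chi> \<ge> 3")
    case True
    then show ?thesis by (rule tournament_pair_with_many_colours)
  next
    case False
    then have "\<chi> = 1 \<or> \<chi> = 2" using assms by linarith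
    from tournament_pair_with_few_colours[OF this, of M] show ?thesis by blast
  qed
qed

end
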